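(* Let $(\mathscr E,t)=\{t_k\}_{k=0}^N$ be a finite-length $\mathcal A$-Hilbert complex. Then the even Dirac operator $\mathcal D^+_t\colon \mathrm{dom}(\mathcal D^+_t)\subset\mathscr E_{\mathrm{ev}}\to\mathscr E_{\mathrm{odd}}$ is a regular operator, and its adjoint is the odd Dirac operator $\mathcal D^-_t\colon \mathrm{dom}(\mathcal D^-_t)\subset\mathscr E_{\mathrm{odd}}\to\mathscr E_{\mathrm{ev}}$.
   Context: $\mathcal A$ is a fixed complex C*-algebra. Hilbert $\mathcal A$-modules are right Hilbert C*-modules over $\mathcal A$; $\oplus$ is the orthogonal direct sum. A densely defined $\mathcal A$-linear operator $t\colon \mathrm{dom}(t)\subset \mathscr E\to\mathscr F$ between Hilbert $\mathcal A$-modules is semi-regular if its adjoint $t^*$ is densely defined; a semi-regular $t$ is regular if it is closed and $1+t^*t$ has dense range. $\mathcal R_{\mathcal A}(\mathscr E,\mathscr F)$ denotes the set of regular operators from $\mathscr E$ to $\mathscr F$. An $\mathcal A$-Hilbert complex $(\mathscr E,t)$ is a sequence of regular operators $t_k\in\mathcal R_{\mathcal A}(\mathscr E_k,\mathscr E_{k+1})$, $k\in\mathbb Z$, between Hilbert $\mathcal A$-modules, with $\mathrm{ran}(t_k)\subset\ker(t_{k+1})$ for all $k$. It has finite length if $\mathscr E_k=0$ for $|k|$ large; it is then indexed so that $\mathscr E_k=0$ unless $0\le k\le N+1$, written $\{t_k\}_{k=0}^N$, and $t_k=0$ (everywhere defined) for $k<0$ or $k>N$. For a finite-length complex put $\mathscr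 E_{\mathrm{ev}}=\bigoplus_k\mathscr E_{2k}$ and $\mathscr E_{\mathrm{odd}}=\bigoplus_k\mathscr E_{2k+1}$. The even Dirac operator has domain $\mathrm{dom}(\mathcal D^+_t)=\bigoplus_k \mathrm{dom}(t_{2k})\cap\mathrm{dom}(t_{2k-1}^* )$ and is given by $\mathcal D^+_t(x_{2k})_k=(t_{2k}x_{2k}+t_{2k+1}^*x_{2k+2})_k$. The odd Dirac operator has domain $\mathrm{dom}(\mathcal D^-_t)=\bigoplus_k \mathrm{dom}(t_{2k}^* )\cap\mathrm{dom}(t_{2k+1})$ and is given by $\mathcal D^-_t(y_{2k+1})_k=(t_{2k}^*y_{2k+1}+t_{2k-1}y_{2k-1})_k$. *)

theory Defs
  imports "HOL-Analysis.Analysis" "HOL-Algebra.Algebraic_Closure_Type"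
begin

section \<open>C*-algebras\<close>

text \<open>
  Complex C*-algebras, not necessarily unital. The real scalar multiplication of
  \<^class>\<open>real_normed_algebra\<close> is the restriction of the complex one.
\<close>

class cstar_algebra = real_normed_algebra + banach +
  fixes scaleC :: "complex \<Rightarrow> 'a \<Rightarrow> 'a"
    and star :: "'a \<Rightarrow> 'a"
  assumes scaleC_add_right: "scaleC c (a + b) = scaleC c a + scaleC c b"
    and scaleC_add_left: "scaleC (c + d) a = scaleC c a + scaleC d a"
    and scaleC_scaleC: "scaleC c (scaleC d a) = scaleC (c * d) a"
    and scaleR_scaleC: "scaleR r a = scaleC (complex_of_real r) a"
    and scaleC_mult_left: "scaleC c a * b = scaleC c (a * b)"
    and scaleC_mult_right: "a * scaleC c b = scaleC c (a * b)"
    and norm_scaleC: "norm (scaleC c a) = cmod c * norm a"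
    and star_star: "star (star a) = a"
    and star_add: "star (a + b) = star a + star b"
    and star_scaleC: "star (scaleC c a) = scaleC (cnj c) (star a)"
    and star_mult: "star (a * b) = star b * star a"
    and cstar_identity: "norm (star a * a) = (norm a)\<^sup>2"

definition positive :: "'a::cstar_algebra \<Rightarrow> bool" where
  "positive a \<longleftrightarrow> (\<exists>b. a = star b * b)"


section \<open>Hilbert modules\<close>

text \<open>
  Families of modules indexed by the integers occur below, so modules are records with a
  carrier. The complex vector space structure is that of a HOL-Algebra module over the ring of
  complex numbers; as always for such modules, the inherited fields \<open>mult\<close> and \<open>one\<close> are
  irrelevant. The inner product is conjugate linear in its first argument.
\<close>

record ('a, 'e) hmodule = "(complex, 'e) module" +
  ract :: "'e \<Rightarrow> 'a \<Rightarrow> 'e"  (infixl \<open>\<triangleleft>\<index>\<close> 72)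
  ip :: "'e \<Rightarrow> 'e \<Rightarrow> 'a"  (\<open>\<langle>_,_\<rangle>\<index>\<close>)

definition hnorm :: "('a::cstar_algebra, 'e) hmodule \<Rightarrow> 'e \<Rightarrow> real" where
  "hnorm E x = sqrt (norm (\<langle>x, x\<rangle>\<^bsub>E\<^esub>))"

definition hdist :: "('a::cstar_algebra, 'e) hmodule \<Rightarrow> 'e \<Rightarrow> 'e \<Rightarrow> real" where
  "hdist E x y = hnorm E (x \<ominus>\<^bsub>E\<^esub> y)"

definition hlimit :: "('a::cstar_algebra, 'e) hmodule \<Rightarrow> (nat \<Rightarrow> 'e) \<Rightarrow> 'e \<Rightarrow> bool" where
  "hlimit E u x \<longleftrightarrow> (\<lambda>n. hdist E (u n) x) \<longlonglongrightarrow> 0"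

definition hcauchy :: "('a::cstar_algebra, 'e) hmodule \<Rightarrow> (nat \<Rightarrow> 'e) \<Rightarrow> bool" where
  "hcauchy E u \<longleftrightarrow> (\<forall>\<epsilon>>0. \<exists>M. \<forall>m\<ge>M. \<forall>n\<ge>M. hdist E (u m) (u n) < \<epsilon>)"

definition hdense :: "('a::cstar_algebra, 'e) hmodule \<Rightarrow> 'e set \<Rightarrow> bool" where
  "hdense E S \<longleftrightarrow> S \<subseteq> carrier E \<and> (\<forall>x\<in>carrier E. \<forall>\<epsilon>>0. \<exists>y\<in>S. hdist E x y < \<epsilon>)"

locale hilbert_module =
  Module.module "ring_of_type_algebra :: complex ring" E
  for E :: "('a::cstar_algebra, 'e) hmodule" (structure) +
  assumes ract_closed: "x \<in> carrier E \<Longrightarrow> x \<triangleleft> a \<in> carrier E"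
    and ract_add_right: "x \<in> carrier E \<Longrightarrow> x \<triangleleft> (a + b) = x \<triangleleft> a \<oplus> x \<triangleleft> b"
    and ract_add_left: "x \<in> carrier E \<Longrightarrow> y \<in> carrier E \<Longrightarrow> (x \<oplus> y) \<triangleleft> a = x \<triangleleft> a \<oplus> y \<triangleleft> a"
    and ract_mult: "x \<in> carrier E \<Longrightarrow> x \<triangleleft> (a * b) = (x \<triangleleft> a) \<triangleleft> b"
    and ract_smult: "x \<in> carrier E \<Longrightarrow> (c \<odot> x) \<triangleleft> a = c \<odot> (x \<triangleleft> a)"
    and ract_scaleC: "x \<in> carrier E \<Longrightarrow> x \<triangleleft> scaleC c a = c \<odot> (x \<triangleleft> a)"
    and ip_add_right: "x \<in> carrier E \<Longrightarrow> y \<in> carrier E \<Longrightarrow> z \<in> carrier E \<Longrightarrow>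
          \<langle>x, y \<oplus> z\<rangle> = \<langle>x, y\<rangle> + \<langle>x, z\<rangle>"
    and ip_smult_right: "x \<in> carrier E \<Longrightarrow> y \<in> carrier E \<Longrightarrow> \<langle>x, c \<odot> y\<rangle> = scaleC c (\<langle>x, y\<rangle>)"
    and ip_ract_right: "x \<in> carrier E \<Longrightarrow> y \<in> carrier E \<Longrightarrow> \<langle>x, y \<triangleleft> a\<rangle> = \<langle>x, y\<rangle> * a"
    and ip_star: "x \<in> carrier E \<Longrightarrow> y \<in> carrier E \<Longrightarrow> star (\<langle>x, y\<rangle>) = \<langle>y, x\<rangle>"
    and ip_positive: "x \<in> carrier E \<Longrightarrow> positive (\<langle>x, x\<rangle>)"
    and ip_definite: "x \<in> carrier E \<Longrightarrow> \<langle>x, x\<rangle> = 0 \<Longrightarrow> x = \<zero>"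
    and complete: "(\<And>n. u n \<in> carrier E) \<Longrightarrow> hcauchy E u \<Longrightarrow> \<exists>x\<in>carrier E. hlimit E u x"

text \<open>
  The orthogonal direct sum of a family of modules: all \<open>x\<close> such that \<open>\<Sum>\<^sub>k \<langle>x\<^sub>k, x\<^sub>k\<rangle>\<close> converges in
  norm. If all but finitely many summands are zero, this condition is void and the sums are finite.
\<close>

definition direct_sum :: "('i \<Rightarrow> ('a::cstar_algebra, 'e) hmodule) \<Rightarrow> ('a, 'i \<Rightarrow> 'e) hmodule" where
  "direct_sum M =
    \<lparr> carrier = {x. (\<forall>k. x k \<in> carrier (M k)) \<and> (\<lambda>k. \<langle>x k, x k\<rangle>\<^bsub>M k\<^esub>) summable_on UNIV},
      monoid.mult = undefined,
      one = undefined,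
      ring.zero = (\<lambda>k. \<zero>\<^bsub>M k\<^esub>),
      add = (\<lambda>x y k. x k \<oplus>\<^bsub>M k\<^esub> y k),
      smult = (\<lambda>c x k. c \<odot>\<^bsub>M k\<^esub> x k),
      ract = (\<lambda>x a k. x k \<triangleleft>\<^bsub>M k\<^esub> a),
      ip = (\<lambda>x y. \<Sum>\<^sub>\<infinity>k. \<langle>x k, y k\<rangle>\<^bsub>M k\<^esub>) \<rparr>"


section \<open>Regular operators\<close>

text \<open>
  An operator with domain in \<open>E\<close> and values in \<open>F\<close> is a partial function \<open>t\<close>, its domain is
  \<^term>\<open>dom t\<close> and its range \<^term>\<open>ran t\<close>. Equality of operators includes equality of domains.
\<close>

definition densely_defined_operator ::
  "('a::cstar_algebra, 'e) hmodule \<Rightarrow> ('a, 'f) hmodule \<Rightarrow> ('e \<rightharpoonup> 'f) \<Rightarrow> bool" where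
  "densely_defined_operator E F t \<longleftrightarrow>
     hilbert_module E \<and> hilbert_module F \<and>
     hdense E (dom t) \<and> ran t \<subseteq> carrier F \<and>
     (\<forall>x\<in>dom t. \<forall>y\<in>dom t. t (x \<oplus>\<^bsub>E\<^esub> y) = Some (the (t x) \<oplus>\<^bsub>F\<^esub> the (t y))) \<and>
     (\<forall>c. \<forall>x\<in>dom t. t (c \<odot>\<^bsub>E\<^esub> x) = Some (c \<odot>\<^bsub>F\<^esub> the (t x))) \<and>
     (\<forall>a. \<forall>x\<in>dom t. t (x \<triangleleft>\<^bsub>E\<^esub> a) = Some (the (t x) \<triangleleft>\<^bsub>F\<^esub> a))"

text \<open>
  The vector \<open>z\<close> below is unique if \<open>t\<close> is densely defined.
\<close>

definition adjoint_op ::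
  "('a::cstar_algebra, 'e) hmodule \<Rightarrow> ('a, 'f) hmodule \<Rightarrow> ('e \<rightharpoonup> 'f) \<Rightarrow> ('f \<rightharpoonup> 'e)" where
  "adjoint_op E F t = (\<lambda>y.
     let P = (\<lambda>z. z \<in> carrier E \<and> (\<forall>x\<in>dom t. \<langle>the (t x), y\<rangle>\<^bsub>F\<^esub> = \<langle>x, z\<rangle>\<^bsub>E\<^esub>))
     in if y \<in> carrier F \<and> (\<exists>z. P z) then Some (THE z. P z) else None)"

definition semi_regular ::
  "('a::cstar_algebra, 'e) hmodule \<Rightarrow> ('a, 'f) hmodule \<Rightarrow> ('e \<rightharpoonup> 'f) \<Rightarrow> bool" where
  "semi_regular E F t \<longleftrightarrow> densely_defined_operator E F t \<and> hdense F (dom (adjoint_op E F t))"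

definition closed_operator ::
  "('a::cstar_algebra, 'e) hmodule \<Rightarrow> ('a, 'f) hmodule \<Rightarrow> ('e \<rightharpoonup> 'f) \<Rightarrow> bool" where
  "closed_operator E F t \<longleftrightarrow>
     (\<forall>u x y. (\<forall>n. u n \<in> dom t) \<and> x \<in> carrier E \<and> y \<in> carrier F \<and>
        hlimit E u x \<and> hlimit F (\<lambda>n. the (t (u n))) y \<longrightarrow> t x = Some y)"

definition one_plus :: "('a::cstar_algebra, 'e) hmodule \<Rightarrow> ('e \<rightharpoonup> 'e) \<Rightarrow> ('e \<rightharpoonup> 'e)" where
  "one_plus E s = (\<lambda>x. map_option (\<lambda>y. x \<oplus>\<^bsub>E\<^esub> y) (s x))"

definition regular ::
  "('a::cstar_algebra, 'e) hmodule \<Rightarrow> ('a, 'f) hmodule \<Rightarrow> ('e \<rightharpoonup> 'f) \<Rightarrow> bool" where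
  "regular E F t \<longleftrightarrow>
     semi_regular E F t \<and> closed_operator E F t \<and>
     hdense E (ran (one_plus E (adjoint_op E F t \<circ>\<^sub>m t)))"


section \<open>Hilbert complexes and their Dirac operators\<close>

definition kernel_op :: "('a::cstar_algebra, 'f) hmodule \<Rightarrow> ('e \<rightharpoonup> 'f) \<Rightarrow> 'e set" where
  "kernel_op F t = {x. t x = Some \<zero>\<^bsub>F\<^esub>}"

definition hilbert_complex ::
  "(int \<Rightarrow> ('a::cstar_algebra, 'e) hmodule) \<Rightarrow> (int \<Rightarrow> 'e \<rightharpoonup> 'e) \<Rightarrow> bool" where
  "hilbert_complex E t \<longleftrightarrow>
     (\<forall>k. hilbert_module (E k)) \<and>
     (\<forall>k. regular (E k) (E (k + 1)) (t k)) \<and>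
     (\<forall>k. ran (t k) \<subseteq> kernel_op (E (k + 2)) (t (k + 1)))"

definition finite_length_hilbert_complex ::
  "nat \<Rightarrow> (int \<Rightarrow> ('a::cstar_algebra, 'e) hmodule) \<Rightarrow> (int \<Rightarrow> 'e \<rightharpoonup> 'e) \<Rightarrow> bool" where
  "finite_length_hilbert_complex N E t \<longleftrightarrow>
     hilbert_complex E t \<and>
     (\<forall>k. k \<notin> {0..int N + 1} \<longrightarrow> carrier (E k) = {\<zero>\<^bsub>E k\<^esub>}) \<and>
     (\<forall>k. k \<notin> {0..int N} \<longrightarrow> (\<forall>x\<in>carrier (E k). t k x = Some \<zero>\<^bsub>E (k + 1)\<^esub>))"

abbreviation adjoint_at ::
  "(int \<Rightarrow> ('a::cstar_algebra, 'e) hmodule) \<Rightarrow> (int \<Rightarrow> 'e \<rightharpoonup> 'e) \<Rightarrow> int \<Rightarrow> ('e \<rightharpoonup> 'e)" where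
  "adjoint_at E t k \<equiv> adjoint_op (E k) (E (k + 1)) (t k)"

text \<open>
  The component with index \<open>k\<close> of an element of the even (odd) part lies in \<open>E\<^sub>2\<^sub>k\<close>
  (in \<open>E\<^sub>2\<^sub>k\<^sub>+\<^sub>1\<close>).
\<close>

definition even_part ::
  "(int \<Rightarrow> ('a::cstar_algebra, 'e) hmodule) \<Rightarrow> ('a, int \<Rightarrow> 'e) hmodule" where
  "even_part E = direct_sum (\<lambda>k. E (2 * k))"

definition odd_part ::
  "(int \<Rightarrow> ('a::cstar_algebra, 'e) hmodule) \<Rightarrow> ('a, int \<Rightarrow> 'e) hmodule" where
  "odd_part E = direct_sum (\<lambda>k. E (2 * k + 1))"

definition dirac_even ::
  "(int \<Rightarrow> ('a::cstar_algebra, 'e) hmodule) \<Rightarrow> (int \<Rightarrow> 'e \<rightharpoonup> 'e) \<Rightarrow> ((int \<Rightarrow> 'e) \<rightharpoonup> (int \<Rightarrow> 'e))" where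
  "dirac_even E t = (\<lambda>x.
     if x \<in> carrier (even_part E) \<and> (\<forall>k. x k \<in> dom (t (2 * k)) \<inter> dom (adjoint_at E t (2 * k - 1)))
     then Some (\<lambda>k. the (t (2 * k) (x k)) \<oplus>\<^bsub>E (2 * k + 1)\<^esub>
                    the (adjoint_at E t (2 * k + 1) (x (k + 1))))
     else None)"

definition dirac_odd ::
  "(int \<Rightarrow> ('a::cstar_algebra, 'e) hmodule) \<Rightarrow> (int \<Rightarrow> 'e \<rightharpoonup> 'e) \<Rightarrow> ((int \<Rightarrow> 'e) \<rightharpoonup> (int \<Rightarrow> 'e))" where
  "dirac_odd E t = (\<lambda>y.
     if y \<in> carrier (odd_part E) \<and> (\<forall>k. y k \<in> dom (adjoint_at E t (2 * k)) \<inter> dom (t (2 * k + 1)))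
     then Some (\<lambda>k. the (adjoint_at E t (2 * k) (y k)) \<oplus>\<^bsub>E (2 * k)\<^esub>
                    the (t (2 * k - 1) (y (k - 1))))
     else None)"

end

theory Submission
  imports Defs
begin

text \<open>
  Fix two consecutive operators \<open>s\<close> and \<open>t\<close> of the complex, so that \<open>t s = 0\<close> and hence
  \<open>s\<^sup>\<star> t\<^sup>\<star> = 0\<close>. Regularity makes \<open>1 + t\<^sup>\<star>t\<close> and \<open>1 + s s\<^sup>\<star>\<close> surjective; let \<open>P\<close> and \<open>Q\<close> be their inverses.
  Because \<open>1 - P = t\<^sup>\<star>tP\<close> takes values in the kernel of \<open>s\<^sup>\<star>\<close> and \<open>1 - Q = s s\<^sup>\<star>Q\<close> takes values in
  the kernel of \<open>t\<close>, the operator \<open>R = P + Q - 1\<close> inverts \<open>1 + t\<^sup>\<star>t + s s\<^sup>\<star>\<close>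
  (\<open>solve_one_plus_laplacian\<close>). Assembling these inverses
  over the degrees shows that \<open>1 + D\<^sup>-D\<^sup>+\<close> and \<open>1 + D\<^sup>+D\<^sup>-\<close> are surjective (\<open>surjective\<close>).

  The rest is a criterion of von Neumann type: if two densely defined operators are formally adjoint
  and both \<open>1 + st\<close> and \<open>1 + ts\<close> are onto, then the graph of \<open>t\<close> and the flipped graph of \<open>s\<close> span
  the sum of the modules, so each operator is the adjoint of the other and both are regular
  (\<open>regular_if_surjective\<close>). Density of the domain of the Dirac operator has to be
  shown by approximation, since a proper closed submodule of a Hilbert module may have trivial orthogonal
  complement. It rests on the density of the domain of \<open>t\<^sup>\<star>t\<close> (\<open>dense_core\<close>), proved by an
  explicit iteration, followed by an application of \<open>P\<close> to vectors in the domain of \<open>s\<^sup>\<star>\<close>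
  (\<open>dense_common_domain\<close>).

  Even and odd parts play symmetric roles, and so do the operators and their adjoints. The locale
  \<open>bidiagonal\<close> isolates a situation that is closed under this duality, so that every
  statement about \<open>D\<^sup>+\<close> yields the one about \<open>D\<^sup>-\<close>.

  The inequalities that replace the Hilbert space ones (Cauchy-Schwarz, monotonicity of the norm on
  positive elements) and the positivity of inner products on direct sums require that elements
  \<open>b\<^sup>\<star>b\<close> of a C*-algebra are squares of self-adjoint elements and form a cone. This is derived
  from an iteration for square roots that converges in norm (\<open>selfadjoint_square_add\<close>,
  \<open>selfadjoint_square_star_mult\<close>).
\<close>

section \<open>The involution and the scalars\<close>

lemma scaleR_double: "(2 * r) *\<^sub>R x = r *\<^sub>R x + r *\<^sub>R (x::'a::real_vector)"
  by (simp only: mult_2 scaleR_left_distrib)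

lemma star_zero [simp]: "star (0::'a::cstar_algebra) = 0"
  using star_add[of "0::'a" 0] by simp

lemma star_minus [simp]: "star (- a) = - star (a::'a::cstar_algebra)"
  using star_add[of a "-a"] by (simp add: eq_neg_iff_add_eq_0 add.commute)

lemma star_diff: "star (a - b) = star a - star (b::'a::cstar_algebra)"
  using star_add[of a "-b"] by simp

lemma star_scaleR: "star (r *\<^sub>R a) = r *\<^sub>R star (a::'a::cstar_algebra)"
  by (simp add: scaleR_scaleC star_scaleC)

lemma norm_star [simp]: "norm (star a) = norm (a::'a::cstar_algebra)"
proof -
  have le: "norm b \<le> norm (star b)" for b :: 'a
  proof (cases "b = 0")
    case False
    have "norm b * norm b \<le> norm (star b) * norm b"
      using norm_mult_ineq[of "star b" b] by (simp add: cstar_identity power2_eq_square)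
    with False show ?thesis by simp
  qed simp
  show ?thesis using le[of a] le[of "star a"] by (simp add: star_star)
qed

lemma tendsto_star:
  fixes u :: "nat \<Rightarrow> 'a::cstar_algebra"
  assumes "u \<longlonglongrightarrow> l"
  shows "(\<lambda>n. star (u n)) \<longlonglongrightarrow> star l"
proof -
  have "(\<lambda>n. norm (star (u n) - star l)) \<longlonglongrightarrow> 0"
    using assms by (simp add: star_diff[symmetric] LIM_zero_iff tendsto_norm_zero_iff)
  then show ?thesis by (simp add: tendsto_norm_zero_iff LIM_zero_iff)
qed

lemma norm_selfadjoint_square:
  "star s = s \<Longrightarrow> norm (s * s) = (norm (s::'a::cstar_algebra))\<^sup>2"
  using cstar_identity[of s] by simp

lemma norm_le_if_left_mult_le:
  fixes v :: "'a::cstar_algebra"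
  assumes "\<And>b. norm (v * b) \<le> r * norm b" "0 \<le> r"
  shows "norm v \<le> r"
proof (cases "v = 0")
  case False
  have "norm v * norm v \<le> r * norm v"
    using assms(1)[of "star v"] cstar_identity[of "star v"]
    by (simp add: star_star power2_eq_square)
  with False show ?thesis by simp
qed (simp add: assms)

lemma scaleC_zero [simp]: "scaleC 0 a = (0::'a::cstar_algebra)"
  using scaleR_scaleC[of 0 a] by simp

lemma scaleC_minus_left: "scaleC (- c) a = - scaleC c (a::'a::cstar_algebra)"
  using scaleC_add_left[of c "-c" a] by (simp add: eq_neg_iff_add_eq_0 add.commute)

lemma scaleC_zero_right [simp]: "scaleC c (0::'a::cstar_algebra) = 0"
  using scaleC_add_right[of c "0::'a" 0] by simp

lemma scaleC_one [simp]: "scaleC 1 a = (a::'a::cstar_algebra)"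
  using scaleR_scaleC[of 1 a] by simp

lemma scaleC_minus_right: "scaleC c (- a) = - scaleC c (a::'a::cstar_algebra)"
  using scaleC_add_right[of c a "-a"] by (simp add: eq_neg_iff_add_eq_0 add.commute)

lemma scaleC_diff_right: "scaleC c (a - b) = scaleC c a - scaleC c (b::'a::cstar_algebra)"
  using scaleC_add_right[of c a "-b"] by (simp add: scaleC_minus_right)

lemma star_sum: "star (\<Sum>i\<in>I. f i) = (\<Sum>i\<in>I. star (f i::'a::cstar_algebra))"
  by (induction I rule: infinite_finite_induct) (simp_all add: star_add)

lemma scaleC_sum: "scaleC c (\<Sum>i\<in>I. f i) = (\<Sum>i\<in>I. scaleC c (f i::'a::cstar_algebra))"
  by (induction I rule: infinite_finite_induct) (simp_all add: scaleC_add_right)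

text \<open>
  The operators \<open>f + \<i>g\<close> and \<open>f - \<i>g\<close> are isometric, being unitary when \<open>f\<close> and \<open>g\<close> are commuting
  self-adjoint operators with \<open>f\<^sup>2 + g\<^sup>2 = 1\<close>, and \<open>f\<close> is their mean. Formulating this for functions on the algebra
  covers multipliers \<open>x \<mapsto> c x + v x\<close> of the unitization, which need not come from an element.
\<close>

lemma norm_le_of_commuting_squares:
  fixes f g :: "'a::cstar_algebra \<Rightarrow> 'a"
  assumes f: "\<And>x y. star (f x) * y = star x * f y"
    and g: "\<And>x y. star (g x) * y = star x * g y"
    and fg: "\<And>x. f (g x) = g (f x)"
    and sq: "\<And>x. f (f x) + g (g x) = x"
  shows "norm (f x) \<le> norm x"
proof -
  have *: "norm (f x + scaleC c (g x)) = norm x" if c: "c = \<i> \<or> c = - \<i>" for c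
  proof -
    have cc: "cnj c = - c" "cnj c * c = 1" using c by auto
    have "star (f x + scaleC c (g x)) * (f x + scaleC c (g x))
        = star (f x) * f x + scaleC (cnj c * c) (star (g x) * g x)
          + (scaleC c (star (f x) * g x) + scaleC (cnj c) (star (g x) * f x))"
      by (simp add: star_add star_scaleC distrib_left distrib_right scaleC_mult_left
          scaleC_mult_right scaleC_add_right scaleC_scaleC add_ac mult.commute[of c])
    also have "\<dots> = star x * (f (f x) + g (g x))"
      unfolding cc(2) f g fg unfolding cc(1) by (simp add: scaleC_minus_left distrib_left)
    finally have "(norm (f x + scaleC c (g x)))\<^sup>2 = (norm x)\<^sup>2"
      by (metis sq cstar_identity)
    then show ?thesis by simp
  qed
  have "2 *\<^sub>R f x = (f x + scaleC \<i> (g x)) + (f x + scaleC (- \<i>) (g x))"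
    by (simp add: scaleC_minus_left scaleR_2)
  then have "norm (2 *\<^sub>R f x) \<le> norm x + norm x"
    by (metis * norm_triangle_ineq)
  then show ?thesis by simp
qed

section \<open>Square roots in a C*-algebra\<close>

text \<open>
  A square root of \<open>1 - x\<close> is \<open>1 - z\<close> with \<open>z = (x + z\<^sup>2)/2\<close>, and the iterates starting at \<open>0\<close> are
  polynomials in \<open>x\<close> with nonnegative coefficients. In the unitization put \<open>x = c - h\<close> with a real
  \<open>c\<close> and an element \<open>h\<close> of the algebra; then the iterates have the form \<open>z = root_scalar c n - root_approx c h n\<close>
  and the recursion can be run without adjoining a unit.
\<close>

fun root_scalar :: "real \<Rightarrow> nat \<Rightarrow> real" where
  "root_scalar c 0 = 0"
| "root_scalar c (Suc n) = (c + (root_scalar c n)\<^sup>2) / 2"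

fun root_approx :: "real \<Rightarrow> 'a::cstar_algebra \<Rightarrow> nat \<Rightarrow> 'a" where
  "root_approx c h 0 = 0"
| "root_approx c h (Suc n) =
     (1/2) *\<^sub>R (h + (2 * root_scalar c n) *\<^sub>R root_approx c h n - root_approx c h n * root_approx c h n)"

declare root_scalar.simps(2) [simp del] root_approx.simps(2) [simp del]

text \<open>
  With \<open>\<delta> = sqrt (1 - c)\<close>, the element \<open>\<delta> + shifted_root c h\<close> of the unitization is a square root
  of \<open>1 - c + h\<close>. For \<open>c = 1\<close> this is a square root of \<open>h\<close> inside the algebra.
\<close>

definition shifted_root :: "real \<Rightarrow> 'a::cstar_algebra \<Rightarrow> 'a" where
  "shifted_root c h = lim (root_approx c h)"

lemma root_scalar_bounds:
  assumes "0 \<le> c" "c \<le> 1"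
  shows "0 \<le> root_scalar c n" "root_scalar c n \<le> 1 - sqrt (1 - c)"
proof -
  show nn: "0 \<le> root_scalar c n" for n by (cases n) (auto simp: assms root_scalar.simps(2))
  show "root_scalar c n \<le> 1 - sqrt (1 - c)"
  proof (induction n)
    case (Suc n)
    have "(root_scalar c n)\<^sup>2 \<le> (1 - sqrt (1 - c))\<^sup>2" by (intro power_mono Suc nn)
    also have "\<dots> = 2 - c - 2 * sqrt (1 - c)" using assms by (simp add: power2_diff)
    finally show ?case by (simp add: root_scalar.simps(2))
  qed (use assms in auto)
qed

lemma root_scalar_mono:
  assumes "0 \<le> c" "c \<le> 1"
  shows "root_scalar c n \<le> root_scalar c (Suc n)"
proof (induction n)
  case (Suc n)
  then have "(root_scalar c n)\<^sup>2 \<le> (root_scalar c (Suc n))\<^sup>2"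
    by (intro power_mono root_scalar_bounds assms)
  then show ?case by (simp add: root_scalar.simps(2)[of c "Suc n"]) (simp add: root_scalar.simps(2))
qed (use assms in \<open>auto simp: root_scalar.simps(2)\<close>)

lemma root_scalar_le_root_scalar_1:
  assumes "0 \<le> c" "c \<le> 1"
  shows "root_scalar c n \<le> root_scalar 1 n"
proof (induction n)
  case (Suc n)
  then have "(root_scalar c n)\<^sup>2 \<le> (root_scalar 1 n)\<^sup>2"
    by (intro power_mono root_scalar_bounds assms)
  then show ?case using assms by (simp add: root_scalar.simps(2))
qed simp

lemma root_scalar_step:
  "root_scalar c (Suc (Suc n)) - root_scalar c (Suc n) =
    (root_scalar c (Suc n) - root_scalar c n) * (root_scalar c (Suc n) + root_scalar c n) / 2"
  unfolding root_scalar.simps(2)[of c "Suc n"]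
  by (subst (2) root_scalar.simps(2))
     (simp add: power2_eq_square field_simps)

text \<open>
  The scalar sequence for \<open>c = 1\<close> dominates all others: it serves as a majorant, and it converges,
  which will give absolute convergence of the algebra valued sequences.
\<close>

lemma root_scalar_step_le:
  assumes "0 \<le> c" "c \<le> 1"
  shows "root_scalar c (Suc n) - root_scalar c n \<le> root_scalar 1 (Suc n) - root_scalar 1 n"
proof (induction n)
  case (Suc n)
  have "(root_scalar c (Suc n) - root_scalar c n) * (root_scalar c (Suc n) + root_scalar c n)
      \<le> (root_scalar 1 (Suc n) - root_scalar 1 n) * (root_scalar 1 (Suc n) + root_scalar 1 n)"
    using root_scalar_mono[of c n] root_scalar_mono[of 1 n] root_scalar_bounds[OF assms]
    by (intro mult_mono Suc add_mono root_scalar_le_root_scalar_1 assms add_nonneg_nonneg)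
       (simp_all)
  then show ?case unfolding root_scalar_step by simp
qed (use assms in \<open>auto simp: root_scalar.simps(2)\<close>)

lemma root_scalar_tendsto:
  assumes "0 \<le> c" "c \<le> 1"
  shows "root_scalar c \<longlonglongrightarrow> 1 - sqrt (1 - c)"
proof -
  have "incseq (root_scalar c)" using root_scalar_mono[OF assms] by (rule incseq_SucI)
  then obtain L where L: "root_scalar c \<longlonglongrightarrow> L" "\<forall>i. root_scalar c i \<le> L"
    using incseq_convergent root_scalar_bounds(2)[OF assms] by metis
  have "(\<lambda>n. root_scalar c (Suc n)) \<longlonglongrightarrow> (c + L\<^sup>2) / 2"
    unfolding root_scalar.simps(2) by (intro tendsto_intros L) auto
  with L(1) have "L = (c + L\<^sup>2) / 2"
    using LIMSEQ_Suc LIMSEQ_unique by blast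
  then have sq: "(1 - L)\<^sup>2 = 1 - c" by (simp add: power2_diff)
  have "L \<le> 1 - sqrt (1 - c)"
    using LIMSEQ_le_const2[OF L(1)] root_scalar_bounds(2)[OF assms] by blast
  then have "L \<le> 1" using assms by (smt (verit) real_sqrt_ge_zero)
  then have "sqrt (1 - c) = 1 - L" using real_sqrt_unique[OF sq] by simp
  with L show ?thesis by simp
qed

text \<open>
  The hypothesis says that \<open>x = c - h\<close> has norm at most \<open>1\<close> in the unitization. Since the iterates are
  polynomials in \<open>x\<close> with nonnegative coefficients, as are their consecutive differences, their norms are
  bounded by the values of these polynomials at \<open>1\<close>, which are the numbers \<open>root_scalar 1 n\<close>.
\<close>

lemma root_approx_bounds:
  fixes h :: "'a::cstar_algebra"
  assumes c: "0 \<le> c" "c \<le> 1"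
    and h: "\<And>b. norm (c *\<^sub>R b - h * b) \<le> norm b"
  shows "norm (root_scalar c n *\<^sub>R b - root_approx c h n * b) \<le> root_scalar 1 n * norm b"
    and "norm (root_approx c h (Suc n) - root_approx c h n) \<le> 2 * (root_scalar 1 (Suc n) - root_scalar 1 n)"
proof -
  define Z where "Z n b = root_scalar c n *\<^sub>R b - root_approx c h n * b" for n b
  have Z_diff: "Z n (x - y) = Z n x - Z n y" for n x y
    by (simp add: Z_def algebra_simps)
  have Z_Suc: "Z (Suc n) b = (1/2) *\<^sub>R ((c *\<^sub>R b - h * b) + Z n (Z n b))" for n b
  proof -
    have "2 *\<^sub>R Z (Suc n) b = (c *\<^sub>R b - h * b) + Z n (Z n b)"
      by (simp add: Z_def root_scalar.simps(2) root_approx.simps(2) algebra_simps power2_eq_square scaleR_double)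
    then have "(1/2) *\<^sub>R (2 *\<^sub>R Z (Suc n) b) = (1/2) *\<^sub>R ((c *\<^sub>R b - h * b) + Z n (Z n b))"
      by (rule arg_cong)
    then show ?thesis by simp
  qed
  have a0: "0 \<le> root_scalar 1 n" for n by (rule root_scalar_bounds) auto
  show Z_le: "norm (root_scalar c n *\<^sub>R b - root_approx c h n * b) \<le> root_scalar 1 n * norm b" for n b
    unfolding Z_def[symmetric]
  proof (induction n arbitrary: b)
    case (Suc n)
    have "norm (Z n (Z n b)) \<le> root_scalar 1 n * norm (Z n b)" by (rule Suc)
    also have "\<dots> \<le> root_scalar 1 n * (root_scalar 1 n * norm b)" by (intro mult_left_mono Suc a0)
    finally have "norm ((c *\<^sub>R b - h * b) + Z n (Z n b)) \<le> (1 + (root_scalar 1 n)\<^sup>2) * norm b"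
      using norm_triangle_ineq[of "c *\<^sub>R b - h * b" "Z n (Z n b)"] h[of b]
      by (simp add: algebra_simps power2_eq_square)
    then show ?case by (simp add: Z_Suc root_scalar.simps(2))
  qed (simp add: Z_def)
  note Z_le' = Z_le[folded Z_def]
  let ?d = "\<lambda>n. root_scalar 1 (Suc n) - root_scalar 1 n"
  have d0: "0 \<le> ?d n" for n using root_scalar_mono[of 1 n] by simp
  have D_le: "norm (Z (Suc n) b - Z n b) \<le> ?d n * norm b" for n b
  proof (induction n arbitrary: b)
    case 0
    show ?case using h[of b] by (simp add: Z_Suc root_scalar.simps(2)) (simp add: Z_def)
  next
    case (Suc n)
    let ?D = "Z (Suc n) b - Z n b"
    have "Z (Suc (Suc n)) b - Z (Suc n) b
        = (1/2) *\<^sub>R ((c *\<^sub>R b - h * b) + Z (Suc n) (Z (Suc n) b))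
          - (1/2) *\<^sub>R ((c *\<^sub>R b - h * b) + Z n (Z n b))"
      by (rule arg_cong2[OF Z_Suc Z_Suc])
    then have "Z (Suc (Suc n)) b - Z (Suc n) b
        = (1/2) *\<^sub>R (Z (Suc n) ?D + (Z (Suc n) (Z n b) - Z n (Z n b)))"
      by (simp add: scaleR_right_diff_distrib[symmetric] Z_diff)
    moreover have "norm (Z (Suc n) ?D) \<le> root_scalar 1 (Suc n) * (?d n * norm b)"
      by (rule order_trans[OF Z_le' mult_left_mono[OF Suc a0]])
    moreover have "norm (Z (Suc n) (Z n b) - Z n (Z n b)) \<le> ?d n * (root_scalar 1 n * norm b)"
      by (rule order_trans[OF Suc mult_left_mono[OF Z_le' d0]])
    ultimately have "norm (Z (Suc (Suc n)) b - Z (Suc n) b)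
        \<le> (1/2) * (root_scalar 1 (Suc n) * (?d n * norm b) + ?d n * (root_scalar 1 n * norm b))"
      using norm_triangle_ineq[of "Z (Suc n) ?D" "Z (Suc n) (Z n b) - Z n (Z n b)"]
      by (simp only: norm_scaleR) simp
    also have "\<dots> = ?d (Suc n) * norm b"
      unfolding root_scalar_step by (simp add: algebra_simps)
    finally show ?case .
  qed
  let ?V = "root_approx c h (Suc n) - root_approx c h n"
  let ?e = "root_scalar c (Suc n) - root_scalar c n"
  show "norm ?V \<le> 2 * ?d n"
  proof (rule norm_le_if_left_mult_le)
    fix b
    have "?V * b = ?e *\<^sub>R b - (Z (Suc n) b - Z n b)"
      by (simp add: Z_def algebra_simps)
    then have 1: "norm (?V * b) \<le> \<bar>?e\<bar> * norm b + norm (Z (Suc n) b - Z n b)"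
      using norm_triangle_ineq4[of "?e *\<^sub>R b" "Z (Suc n) b - Z n b"] by (simp)
    have 2: "\<bar>?e\<bar> * norm b \<le> ?d n * norm b"
      using root_scalar_mono[OF c, of n] root_scalar_step_le[OF c, of n] by (intro mult_right_mono) auto
    show "norm (?V * b) \<le> 2 * ?d n * norm b"
      using 1 2 D_le[of n b] unfolding mult_2 distrib_right by linarith
  qed (use d0 in simp)
qed

lemma root_approx_tendsto:
  fixes h :: "'a::cstar_algebra"
  assumes c: "0 \<le> c" "c \<le> 1"
    and h: "\<And>b. norm (c *\<^sub>R b - h * b) \<le> norm b"
  shows "root_approx c h \<longlonglongrightarrow> shifted_root c h"
proof -
  have "summable (\<lambda>n. root_scalar 1 (Suc n) - root_scalar 1 n)"
    by (rule telescope_summable[OF root_scalar_tendsto]) auto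
  then have "summable (\<lambda>n. 2 * (root_scalar 1 (Suc n) - root_scalar 1 n))"
    by (rule summable_mult)
  then have "summable (\<lambda>n. root_approx c h (Suc n) - root_approx c h n)"
    by (rule summable_comparison_test'[where N = 0]) (rule root_approx_bounds[OF c h])
  then have "convergent (\<lambda>n. \<Sum>i<n. root_approx c h (Suc i) - root_approx c h i)"
    by (simp only: summable_iff_convergent)
  then have "convergent (root_approx c h)"
    unfolding sum_lessThan_telescope by simp
  then show ?thesis unfolding shifted_root_def by (rule convergent_LIMSEQ_iff[THEN iffD1])
qed

lemma root_eq:
  fixes h :: "'a::cstar_algebra"
  assumes c: "0 \<le> c" "c \<le> 1"
    and h: "\<And>b. norm (c *\<^sub>R b - h * b) \<le> norm b"
  shows "(2 * sqrt (1 - c)) *\<^sub>R shifted_root c h + shifted_root c h * shifted_root c h = h"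
proof -
  let ?s = "shifted_root c h" and ?g = "1 - sqrt (1 - c)"
  have lim: "root_approx c h \<longlonglongrightarrow> ?s" by (rule root_approx_tendsto[OF c h])
  have "(\<lambda>n. root_approx c h (Suc n)) \<longlonglongrightarrow> (1/2) *\<^sub>R (h + (2 * ?g) *\<^sub>R ?s - ?s * ?s)"
    unfolding root_approx.simps(2) by (intro tendsto_intros lim root_scalar_tendsto c)
  with lim have "?s = (1/2) *\<^sub>R (h + (2 * ?g) *\<^sub>R ?s - ?s * ?s)"
    using LIMSEQ_Suc LIMSEQ_unique by blast
  then have "2 *\<^sub>R ?s = 2 *\<^sub>R ((1/2) *\<^sub>R (h + (2 * ?g) *\<^sub>R ?s - ?s * ?s))" by simp
  then have "2 *\<^sub>R ?s = h + (2 * ?g) *\<^sub>R ?s - ?s * ?s" by simp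
  then show ?thesis by (simp add: algebra_simps)
qed

lemma star_root:
  fixes h :: "'a::cstar_algebra"
  assumes c: "0 \<le> c" "c \<le> 1"
    and h: "\<And>b. norm (c *\<^sub>R b - h * b) \<le> norm b" and sa: "star h = h"
  shows "star (shifted_root c h) = shifted_root c h"
proof -
  have "star (root_approx c h n) = root_approx c h n" for n
    by (induction n) (simp_all add: root_approx.simps(2) star_scaleR star_add star_diff star_mult sa)
  then show ?thesis
    using LIMSEQ_unique tendsto_star[OF root_approx_tendsto[OF c h]] root_approx_tendsto[OF c h] by auto
qed

text \<open>
  The roots are limits of polynomials, so they inherit every intertwining relation. For \<open>g = h\<close> this says
  that the root commutes with whatever commutes with \<open>h\<close>.
\<close>

lemma root_intertwines:
  fixes g h :: "'a::cstar_algebra"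
  assumes c: "0 \<le> c" "c \<le> 1"
    and h: "\<And>b. norm (c *\<^sub>R b - h * b) \<le> norm b"
    and g: "\<And>b. norm (c *\<^sub>R b - g * b) \<le> norm b"
    and hg: "h * x = x * g"
  shows "shifted_root c h * x = x * shifted_root c g"
proof -
  have "root_approx c h n * x = x * root_approx c g n" for n
  proof (induction n)
    case (Suc n)
    have "(root_approx c h n * root_approx c h n) * x = x * (root_approx c g n * root_approx c g n)"
      by (metis Suc mult.assoc)
    then show ?case by (simp add: root_approx.simps(2) algebra_simps hg Suc)
  qed simp
  moreover have "(\<lambda>n. root_approx c h n * x) \<longlonglongrightarrow> shifted_root c h * x"
    "(\<lambda>n. x * root_approx c g n) \<longlonglongrightarrow> x * shifted_root c g"
    by (intro tendsto_intros root_approx_tendsto c h g)+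
  ultimately show ?thesis using LIMSEQ_unique by auto
qed

lemma root_contractive:
  fixes h :: "'a::cstar_algebra"
  assumes c: "0 \<le> c" "c \<le> 1"
    and h: "\<And>b. norm (c *\<^sub>R b - h * b) \<le> norm b"
  shows "norm ((1 - sqrt (1 - c)) *\<^sub>R b - shifted_root c h * b) \<le> norm b"
proof (rule LIMSEQ_le_const2)
  show "(\<lambda>n. norm (root_scalar c n *\<^sub>R b - root_approx c h n * b)) \<longlonglongrightarrow>
      norm ((1 - sqrt (1 - c)) *\<^sub>R b - shifted_root c h * b)"
    by (intro tendsto_intros root_approx_tendsto root_scalar_tendsto c h)
  have "root_scalar 1 n * norm b \<le> norm b" for n
    using root_scalar_bounds(2)[of 1 n] by (simp add: mult_left_le_one_le root_scalar_bounds)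
  then show "\<exists>N. \<forall>n\<ge>N. norm (root_scalar c n *\<^sub>R b - root_approx c h n * b) \<le> norm b"
    using root_approx_bounds(1)[OF c h] order_trans by blast
qed

section \<open>Positive elements\<close>

definition selfadjoint_square :: "'a::cstar_algebra \<Rightarrow> bool" where
  "selfadjoint_square h \<longleftrightarrow> (\<exists>s. star s = s \<and> h = s * s)"

text \<open>
  In terms of the norm of the unitization: \<open>1 - h\<close> has norm at most \<open>1\<close>. For self-adjoint \<open>h\<close> of norm
  at most \<open>1\<close> this characterizes positivity, and it is visibly a convex condition.
\<close>

definition sub_unit :: "'a::cstar_algebra \<Rightarrow> bool" where
  "sub_unit h \<longleftrightarrow> (\<forall>b. norm (b - h * b) \<le> norm b)"

lemma star_selfadjoint_square: "selfadjoint_square h \<Longrightarrow> star h = h"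
  by (auto simp: selfadjoint_square_def star_mult)

lemma root_of_sub_unit:
  fixes h :: "'a::cstar_algebra"
  assumes "sub_unit h"
  shows "shifted_root 1 h * shifted_root 1 h = h"
    and "star h = h \<Longrightarrow> star (shifted_root 1 h) = shifted_root 1 h"
    and "sub_unit (shifted_root 1 h)"
    and "sub_unit g \<Longrightarrow> h * x = x * g \<Longrightarrow> shifted_root 1 h * x = x * shifted_root 1 g"
proof -
  have h: "norm (1 *\<^sub>R b - h * b) \<le> norm b" for b
    using assms by (simp add: sub_unit_def)
  show "shifted_root 1 h * shifted_root 1 h = h" using root_eq[OF _ _ h] by simp
  show "star h = h \<Longrightarrow> star (shifted_root 1 h) = shifted_root 1 h" using star_root[OF _ _ h] by simp
  show "sub_unit (shifted_root 1 h)" unfolding sub_unit_def using root_contractive[OF _ _ h] by simp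
  show "shifted_root 1 h * x = x * shifted_root 1 g" if "sub_unit g" "h * x = x * g"
    by (rule root_intertwines) (use assms that in \<open>auto simp: sub_unit_def\<close>)
qed

lemma selfadjoint_square_if_sub_unit:
  "star h = h \<Longrightarrow> sub_unit h \<Longrightarrow> selfadjoint_square (h::'a::cstar_algebra)"
  unfolding selfadjoint_square_def using root_of_sub_unit by metis

text \<open>
  Here \<open>1 - w\<close> is the square root of \<open>1 - p\<close>, written without a unit.
\<close>

lemma ex_one_minus_root:
  fixes p :: "'a::cstar_algebra"
  assumes p: "star p = p" "norm p \<le> 1"
  obtains w where "star w = w" "w + w - w * w = p" "\<And>x. p * x = x * p \<Longrightarrow> w * x = x * w"
proof -
  have le: "norm (0 *\<^sub>R b - (- p) * b) \<le> norm b" for b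
    using p(2) norm_mult_ineq[of p b] mult_left_le_one_le[of "norm b" "norm p"] by simp
  let ?w = "- shifted_root 0 (- p)"
  have "2 *\<^sub>R shifted_root 0 (- p) + shifted_root 0 (- p) * shifted_root 0 (- p) = - p"
    using root_eq[OF _ _ le] by simp
  then have "?w + ?w - ?w * ?w = p"
    by (metis (no_types, lifting) minus_add_distrib minus_minus minus_mult_minus scaleR_2 uminus_add_conv_diff diff_conv_add_uminus)
  moreover have "star ?w = ?w" using star_root[OF _ _ le] p(1) by simp
  moreover have "?w * x = x * ?w" if "p * x = x * p" for x
    using root_intertwines[OF _ _ le le, of x] that by simp
  ultimately show thesis using that by blast
qed

text \<open>
  With \<open>c\<close> the square root of \<open>1 - s\<^sup>2\<close>, the pair \<open>c, s\<close> satisfies \<open>c\<^sup>2 + s\<^sup>2 = 1\<close>, so \<open>c\<close> and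
  therefore \<open>c\<^sup>2 = 1 - s\<^sup>2\<close> are contractive.
\<close>

lemma sub_unit_square:
  fixes s :: "'a::cstar_algebra"
  assumes s: "star s = s" "norm (s * s) \<le> 1"
  shows "sub_unit (s * s)"
proof -
  have "star (s * s) = s * s" by (simp add: star_mult s)
  then obtain w where w: "star w = w" "w + w - w * w = s * s"
      "\<And>x. s * s * x = x * (s * s) \<Longrightarrow> w * x = x * w"
    using ex_one_minus_root s(2) by metis
  define c where "c x = x - w * x" for x
  have cc: "c (c x) = x - s * s * x" for x
    by (simp add: c_def w(2)[symmetric] algebra_simps)
  have ws: "w * s = s * w" by (rule w(3)) (simp add: mult.assoc)
  have "norm (c x) \<le> norm x" for x
  proof (rule norm_le_of_commuting_squares[where f = c and g = "\<lambda>x. s * x"])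
    show "c (s * x) = s * c x" for x
      by (simp add: c_def right_diff_distrib mult.assoc[symmetric] ws)
  qed (simp_all add: cc, simp_all add: c_def star_mult star_diff s w algebra_simps mult.assoc)
  then have "norm (c (c x)) \<le> norm x" for x by (meson order_trans)
  then show ?thesis by (simp add: sub_unit_def cc)
qed

lemma sub_unit_if_selfadjoint_square:
  "selfadjoint_square h \<Longrightarrow> norm h \<le> 1 \<Longrightarrow> sub_unit (h::'a::cstar_algebra)"
  by (auto simp: selfadjoint_square_def intro: sub_unit_square)

lemma selfadjoint_square_scaleR:
  assumes "selfadjoint_square h" "0 \<le> r"
  shows "selfadjoint_square (r *\<^sub>R (h::'a::cstar_algebra))"
proof -
  obtain s where "star s = s" "h = s * s" using assms by (auto simp: selfadjoint_square_def)
  then show ?thesis unfolding selfadjoint_square_def using assms(2)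
    by (intro exI[of _ "sqrt r *\<^sub>R s"]) (simp add: star_scaleR)
qed

lemma selfadjoint_square_scaleR_iff:
  "0 < r \<Longrightarrow> selfadjoint_square (r *\<^sub>R h) \<longleftrightarrow> selfadjoint_square (h::'a::cstar_algebra)"
  using selfadjoint_square_scaleR[of h r] selfadjoint_square_scaleR[of "r *\<^sub>R h" "inverse r"] by auto

text \<open>
  After scaling, both summands satisfy the convex condition \<open>sub_unit\<close>; so does their mean, and that
  condition produces a square root again.
\<close>

lemma selfadjoint_square_add:
  fixes g h :: "'a::cstar_algebra"
  assumes g: "selfadjoint_square g" and h: "selfadjoint_square h"
  shows "selfadjoint_square (g + h)"
proof -
  define r where "r = 1 / (norm g + norm h + 1)"
  have r: "0 < r" by (simp add: r_def add_nonneg_pos)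
  have "sub_unit (r *\<^sub>R g)" "sub_unit (r *\<^sub>R h)"
    using r by (auto intro!: sub_unit_if_selfadjoint_square selfadjoint_square_scaleR g h)
      (simp_all add: r_def field_simps add_nonneg_pos)
  then have le: "norm (b - (r *\<^sub>R g) * b) \<le> norm b" "norm (b - (r *\<^sub>R h) * b) \<le> norm b" for b
    by (auto simp: sub_unit_def)
  have "sub_unit ((r/2) *\<^sub>R (g + h))"
    unfolding sub_unit_def
  proof
    fix b
    have "b - ((r/2) *\<^sub>R (g + h)) * b = (1/2) *\<^sub>R ((b - (r *\<^sub>R g) * b) + (b - (r *\<^sub>R h) * b))"
      by (simp add: algebra_simps flip: scaleR_left_distrib)
    also have "norm \<dots> \<le> norm b"
      using norm_triangle_ineq[of "b - (r *\<^sub>R g) * b" "b - (r *\<^sub>R h) * b"] le[of b]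
      by (simp only: norm_scaleR)
    finally show "norm (b - ((r/2) *\<^sub>R (g + h)) * b) \<le> norm b" .
  qed
  then have "selfadjoint_square ((r/2) *\<^sub>R (g + h))"
    by (intro selfadjoint_square_if_sub_unit) (simp_all add: star_scaleR star_add star_selfadjoint_square g h)
  then show ?thesis using r selfadjoint_square_scaleR_iff[of "r/2"] by auto
qed

text \<open>
  For commuting self-adjoint elements, \<open>s\<^sup>2 + t\<^sup>2 = (s + \<i>t)\<^sup>\<star>(s + \<i>t)\<close>.
\<close>

lemma commuting_squares_add_eq_0:
  fixes s t :: "'a::cstar_algebra"
  assumes "star s = s" "star t = t" "s * t = t * s" "s * s + t * t = 0"
  shows "s = 0" "t = 0"
proof -
  have eq: "star (s + scaleC \<i> t) * (s + scaleC \<i> t) = s * s + t * t"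
    using assms(1-3)
    by (simp add: star_add star_scaleC distrib_left distrib_right left_diff_distrib right_diff_distrib
        scaleC_mult_left scaleC_mult_right scaleC_scaleC scaleC_minus_left scaleC_diff_right)
  have z: "s + scaleC \<i> t = 0"
    using cstar_identity[of "s + scaleC \<i> t"] unfolding eq assms(4) by simp
  then have "star (s + scaleC \<i> t) = 0" by simp
  then have "s + scaleC (- \<i>) t = 0"
    by (simp add: star_add star_scaleC assms(1,2))
  with z have "s + s = 0" by (simp add: scaleC_minus_left add_eq_0_iff)
  then show "s = 0" by (metis scaleR_2 scaleR_eq_0_iff zero_neq_numeral)
  with assms(4) have "norm (t * t) = 0" by simp
  then show "t = 0" using norm_selfadjoint_square[OF assms(2)] by simp
qed

text \<open>
  Uniqueness of the positive square root of \<open>p\<^sup>2\<close>. If \<open>a = r\<^sup>2\<close> and \<open>p = q\<^sup>2\<close> have the same square and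
  everything commutes, then \<open>e = a - p\<close> satisfies \<open>(re)\<^sup>2 + (qe)\<^sup>2 = (a + p)(a - p)e = 0\<close>, whence \<open>ae = pe = 0\<close>
  and \<open>e\<^sup>2 = 0\<close>.
\<close>

lemma root_square_selfadjoint_square:
  fixes p :: "'a::cstar_algebra"
  assumes p: "selfadjoint_square p" and le: "norm p \<le> 1"
  shows "shifted_root 1 (p * p) = p"
proof -
  have sp: "star p = p" by (rule star_selfadjoint_square[OF p])
  have p2: "star (p * p) = p * p" "norm (p * p) \<le> 1"
    using le by (simp_all add: star_mult sp norm_selfadjoint_square power_le_one)
  then have K: "sub_unit (p * p)" using sub_unit_square sp by blast
  define a where "a = shifted_root 1 (p * p)"
  have a: "a * a = p * p" "star a = a" "sub_unit a" using root_of_sub_unit[OF K] p2 by (auto simp: a_def)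
  define r where "r = shifted_root 1 a"
  have r: "r * r = a" "star r = r" using root_of_sub_unit[OF a(3)] a(2) by (auto simp: r_def)
  obtain q where q: "star q = q" "p = q * q" using p by (auto simp: selfadjoint_square_def)
  have "a * q = q * a" unfolding a_def
    by (rule root_of_sub_unit(4)[OF K K]) (simp add: q mult.assoc)
  then have rq: "r * q = q * r" unfolding r_def by (rule root_of_sub_unit(4)[OF a(3) a(3)])
  define e where "e = a - p"
  have ra: "r * a = a * r" by (simp add: r(1)[symmetric] mult.assoc)
  have rp: "r * p = p * r" unfolding q(2) by (metis mult.assoc rq)
  have qa: "q * a = a * q" unfolding r(1)[symmetric] by (metis mult.assoc rq)
  have qp: "q * p = p * q" by (simp add: q(2) mult.assoc)
  have re: "r * e = e * r" and qe: "q * e = e * q"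
    by (simp_all add: e_def left_diff_distrib right_diff_distrib ra rp qa qp)
  have se: "star e = e" by (simp add: e_def star_diff a sp)
  have ap: "a * p = p * a" unfolding r(1)[symmetric] q(2) by (metis mult.assoc rq)
  have "(r * e) * (r * e) = a * e * e" by (metis mult.assoc re r(1))
  moreover have "(q * e) * (q * e) = p * e * e" by (metis mult.assoc qe q(2))
  ultimately have "(r * e) * (r * e) + (q * e) * (q * e) = ((a + p) * e) * e"
    by (simp add: distrib_right)
  also have "(a + p) * e = a * a - p * p" by (simp add: e_def algebra_simps ap)
  finally have sum0: "(r * e) * (r * e) + (q * e) * (q * e) = 0" by (simp add: a)
  have "star (r * e) = r * e" "star (q * e) = q * e"
    by (simp_all add: star_mult se r q(1) re qe)
  moreover have "(r * e) * (q * e) = (q * e) * (r * e)" by (metis mult.assoc re qe rq)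
  ultimately have "r * e = 0" "q * e = 0"
    using commuting_squares_add_eq_0[OF _ _ _ sum0] by auto
  then have "a * e = 0" "p * e = 0"
    by (simp_all add: r(1)[symmetric] q(2) mult.assoc)
  then have "(a - p) * e = 0" by (simp add: left_diff_distrib)
  then have "e * e = 0" by (simp add: e_def)
  then have "norm (e * e) = 0" by simp
  then have "e = 0" using norm_selfadjoint_square[OF se] by simp
  then show ?thesis by (simp add: e_def a_def)
qed

text \<open>
  The identity \<open>c\<^sup>\<star>c + c c\<^sup>\<star> = (x\<^sup>2 + y\<^sup>2)/2\<close> with \<open>x = c + c\<^sup>\<star>\<close> and \<open>y = \<i>(c - c\<^sup>\<star>)\<close> shows that \<open>a = c c\<^sup>\<star>\<close> is
  positive when \<open>b = -c\<^sup>\<star>c\<close> is. Moreover, \<open>a\<^sup>2 c = c b\<^sup>2\<close> implies \<open>\<bar>a\<bar> c = c \<bar>b\<bar>\<close> because absolute values are limits of polynomials in the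
  squares; as \<open>a\<close> and \<open>b\<close> are their own absolute values, \<open>ac = cb = -ac\<close>.
\<close>

lemma eq_0_if_square_negative:
  fixes c :: "'a::cstar_algebra"
  assumes neg: "selfadjoint_square (- (star c * c))" and le: "norm c \<le> 1"
  shows "c = 0"
proof -
  define x where "x = c + star c"
  define y where "y = scaleC \<i> (c - star c)"
  have xy: "star x = x" "star y = y"
    by (simp_all add: x_def y_def star_add star_star star_scaleC star_diff scaleC_minus_left
        scaleC_diff_right add.commute)
  have yy: "y * y = - ((c - star c) * (c - star c))"
    by (simp add: y_def scaleC_mult_left scaleC_mult_right scaleC_scaleC scaleC_minus_left)
  have "2 *\<^sub>R (c * star c) = x * x + y * y + 2 *\<^sub>R (- (star c * c))"
    unfolding yy x_def by (simp add: algebra_simps scaleR_2)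
  moreover have "selfadjoint_square (x * x)" "selfadjoint_square (y * y)"
    using xy by (auto simp: selfadjoint_square_def)
  then have "selfadjoint_square (x * x + y * y + 2 *\<^sub>R (- (star c * c)))"
    by (intro selfadjoint_square_add selfadjoint_square_scaleR neg) auto
  ultimately have "selfadjoint_square (2 *\<^sub>R (c * star c))" by (simp only:)
  then have pos: "selfadjoint_square (c * star c)" by (simp add: selfadjoint_square_scaleR_iff)
  let ?a = "c * star c" and ?b = "- (star c * c)"
  have le1: "norm ?a \<le> 1" "norm ?b \<le> 1"
    using le cstar_identity[of c] cstar_identity[of "star c"] by (simp_all add: star_star power_le_one)
  have K: "sub_unit (?a * ?a)" "sub_unit (?b * ?b)"
    by (intro sub_unit_square; use le1 in \<open>simp add: star_mult star_star norm_selfadjoint_square power_le_one\<close>)+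
  have "shifted_root 1 (?a * ?a) * c = c * shifted_root 1 (?b * ?b)"
    by (rule root_of_sub_unit(4)[OF K]) (simp add: mult.assoc)
  then have "?a * c = c * ?b"
    unfolding root_square_selfadjoint_square[OF pos le1(1)] root_square_selfadjoint_square[OF neg le1(2)] .
  then have "2 *\<^sub>R (c * (star c * c)) = 0" by (simp add: mult.assoc scaleR_2 eq_neg_iff_add_eq_0)
  then have "c * (star c * c) = 0" by simp
  then have "star (star c * c) * (star c * c) = 0" by (simp add: star_mult star_star mult.assoc)
  then have "norm (star (star c * c) * (star c * c)) = 0" by simp
  then show "c = 0" unfolding cstar_identity by simp
qed

text \<open>
  Let \<open>h = b\<^sup>\<star>b\<close> and \<open>m = \<bar>h\<bar> = r\<^sup>2\<close>. The element \<open>n\<close> is half the negative part of \<open>h\<close>, so \<open>nh = -nm\<close>, and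
  \<open>c = bn\<close> satisfies \<open>-c\<^sup>\<star>c = -nhn = nmn = (rn)\<^sup>2\<close>. Therefore \<open>c = 0\<close>, hence \<open>n\<^sup>3 = 0\<close>, \<open>n = 0\<close> and
  \<open>h = m\<close> is positive.
\<close>

lemma selfadjoint_square_star_mult:
  fixes b :: "'a::cstar_algebra"
  assumes le: "norm b \<le> 1"
  shows "selfadjoint_square (star b * b)"
proof -
  define h where "h = star b * b"
  have sh: "star h = h" by (simp add: h_def star_mult star_star)
  have "norm h \<le> 1" using le by (simp add: h_def cstar_identity power_le_one)
  then have h2: "star (h * h) = h * h" "norm (h * h) \<le> 1"
    by (simp_all add: star_mult sh norm_selfadjoint_square power_le_one)
  then have K: "sub_unit (h * h)" using sub_unit_square sh by blast
  define m where "m = shifted_root 1 (h * h)"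
  have m: "m * m = h * h" "star m = m" "sub_unit m" using root_of_sub_unit[OF K] h2 by (auto simp: m_def)
  define r where "r = shifted_root 1 m"
  have r: "r * r = m" "star r = r" using root_of_sub_unit[OF m(3)] m(2) by (auto simp: r_def)
  have mh: "m * h = h * m" unfolding m_def
    by (rule root_of_sub_unit(4)[OF K K]) (simp add: mult.assoc)
  then have rh: "r * h = h * r" unfolding r_def by (rule root_of_sub_unit(4)[OF m(3) m(3)])
  \<comment> \<open>the factor 1/4 instead of 1/2 makes the norm of n, hence that of c, at most 1\<close>
  define n where "n = (1/4) *\<^sub>R (m - h)"
  have sn: "star n = n" by (simp add: n_def star_scaleR star_diff m sh)
  have rn: "r * n = n * r" by (simp add: n_def r(1)[symmetric] algebra_simps rh mult.assoc)
  have nm: "n * (m + h) = 0" by (simp add: n_def algebra_simps m mh)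
  define c where "c = b * n"
  have "star c * c = n * h * n" by (simp add: c_def star_mult sn h_def mult.assoc)
  also have "n * h = - (n * m)" using nm by (simp add: distrib_left add_eq_0_iff2)
  finally have cc: "- (star c * c) = (r * n) * (r * n)"
    by (simp add: r(1)[symmetric]) (metis mult.assoc rn)
  have "norm c \<le> 1"
  proof -
    have "norm m * norm m \<le> 1" using h2(2) norm_selfadjoint_square[OF m(2)] m(1) by (simp add: power2_eq_square)
    then have "norm m \<le> 1" using norm_ge_zero by (metis abs_le_square_iff abs_norm_cancel one_power2 power2_eq_square abs_one)
    then have "norm n \<le> 1"
      using norm_triangle_ineq4[of m h] \<open>norm h \<le> 1\<close> by (simp add: n_def)
    then show ?thesis using le norm_mult_ineq[of b n] mult_le_one[of "norm b" "norm n"] by (simp add: c_def)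
  qed
  moreover have "selfadjoint_square (- (star c * c))"
    unfolding selfadjoint_square_def cc by (intro exI[of _ "r * n"]) (simp add: star_mult sn r rn)
  ultimately have "c = 0" by (rule eq_0_if_square_negative[rotated])
  with cc have "n * h * n = 0" "n * m * n = 0"
    using \<open>star c * c = n * h * n\<close> \<open>n * h = - (n * m)\<close> by auto
  then have "n * (m - h) * n = 0" by (simp add: left_diff_distrib right_diff_distrib)
  moreover have "m - h = 4 *\<^sub>R n" by (simp add: n_def)
  ultimately have "n * n * n = 0" by simp
  then have "(n * n) * (n * n) = 0" by (simp add: mult.assoc)
  then have "norm ((n * n) * (n * n)) = 0" by simp
  then have "n = 0" by (simp add: norm_selfadjoint_square sn star_mult)
  then have "m = h" by (simp add: n_def)
  then show ?thesis using selfadjoint_square_if_sub_unit m(2,3) by (simp add: h_def)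
qed

lemma positive_iff_selfadjoint_square:
  "positive a \<longleftrightarrow> selfadjoint_square (a::'a::cstar_algebra)"
proof
  assume "positive a"
  then obtain b where b: "a = star b * b" by (auto simp: positive_def)
  define r where "r = 1 / (norm b + 1)"
  have r: "0 < r" by (simp add: r_def add_nonneg_pos)
  have "norm (r *\<^sub>R b) \<le> 1" by (simp add: r_def divide_le_eq_1_pos add_nonneg_pos)
  then have "selfadjoint_square ((r * r) *\<^sub>R a)"
    using selfadjoint_square_star_mult[of "r *\<^sub>R b"] by (simp add: b star_scaleR)
  then show "selfadjoint_square a" using r by (simp add: selfadjoint_square_scaleR_iff)
next
  assume "selfadjoint_square a"
  then show "positive a" by (auto simp: selfadjoint_square_def positive_def) metis
qed

lemma positive_add: "positive a \<Longrightarrow> positive b \<Longrightarrow> positive (a + b::'a::cstar_algebra)"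
  by (simp add: positive_iff_selfadjoint_square selfadjoint_square_add)

lemma positive_zero [simp]: "positive (0::'a::cstar_algebra)"
  unfolding positive_def by (rule exI[of _ 0]) simp

lemma positive_scaleR: "positive a \<Longrightarrow> 0 \<le> r \<Longrightarrow> positive (r *\<^sub>R a::'a::cstar_algebra)"
  by (simp add: positive_iff_selfadjoint_square selfadjoint_square_scaleR)

lemma star_positive: "positive a \<Longrightarrow> star a = (a::'a::cstar_algebra)"
  by (auto simp: positive_def star_mult star_star)

lemma positive_sum: "(\<And>i. i \<in> I \<Longrightarrow> positive (f i)) \<Longrightarrow> positive (\<Sum>i\<in>I. f i::'a::cstar_algebra)"
  by (induction I rule: infinite_finite_induct) (auto intro: positive_add)

text \<open>
  The element \<open>(1 - a)/(R + 1)\<close> is \<open>1 - c + h\<close> in the notation of the proof. It has a square root in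
  the unitization because \<open>(R + 1)(c - h) = (R - b) + (a + b)\<close> has norm at most \<open>R + 1\<close>. The resulting square root
  \<open>f\<close> of \<open>1 - a\<close> and a square root \<open>s\<close> of \<open>a\<close> are commuting self-adjoint operators whose squares add up to \<open>1\<close>.
\<close>

lemma norm_le_1_if_le:
  fixes a b :: "'a::cstar_algebra"
  assumes a: "positive a" and b: "positive b" and le: "norm (a + b) \<le> 1" "norm b \<le> R" "1 \<le> R"
  shows "norm a \<le> 1"
proof -
  obtain s where s: "star s = s" "a = s * s"
    using a by (auto simp: positive_iff_selfadjoint_square selfadjoint_square_def)
  define c where "c = 1 - 1 / (R + 1)"
  define h where "h = - ((1 / (R + 1)) *\<^sub>R a)"
  have c: "0 \<le> c" "c \<le> 1" and R: "1 - c = 1 / (R + 1)" using le by (auto simp: c_def)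
  have h: "norm (c *\<^sub>R x - h * x) \<le> norm x" for x
  proof -
    have "sub_unit ((1 / R) *\<^sub>R b)"
      using le b by (intro sub_unit_if_selfadjoint_square selfadjoint_square_scaleR)
        (auto simp: positive_iff_selfadjoint_square field_simps)
    then have bR: "norm (x - ((1 / R) *\<^sub>R b) * x) \<le> norm x" by (auto simp: sub_unit_def)
    have "R *\<^sub>R x - b * x = R *\<^sub>R (x - ((1 / R) *\<^sub>R b) * x)"
      using le by (simp add: scaleR_right_diff_distrib)
    then have 1: "norm (R *\<^sub>R x - b * x) \<le> R * norm x"
      using bR le mult_left_mono[OF bR, of R] by simp
    have 2: "norm ((a + b) * x) \<le> norm x"
      using norm_mult_ineq[of "a + b" x] le(1) mult_left_le_one_le[of "norm x" "norm (a + b)"] by simp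
    have "(R + 1) * c = R" using le by (simp add: c_def field_simps)
    then have "(R + 1) *\<^sub>R (c *\<^sub>R x - h * x) = (R *\<^sub>R x - b * x) + (a + b) * x"
      using le by (simp add: h_def algebra_simps)
    then have "norm ((R + 1) *\<^sub>R (c *\<^sub>R x - h * x)) \<le> (R + 1) * norm x"
      using norm_triangle_ineq[of "R *\<^sub>R x - b * x" "(a + b) * x"] 1 2 by (simp add: distrib_right)
    then show ?thesis using le by simp
  qed
  define v where "v = shifted_root c h"
  define d where "d = sqrt (1 - c)"
  define k where "k = sqrt (R + 1)"
  define f where "f x = k *\<^sub>R (d *\<^sub>R x + v * x)" for x
  have v: "(2 * d) *\<^sub>R v + v * v = h" using root_eq[OF c h] by (simp add: v_def d_def)
  have sv: "star v = v" unfolding v_def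
    by (rule star_root[OF c h]) (simp add: h_def star_scaleR star_positive a)
  have vs: "v * s = s * v" unfolding v_def
    by (rule root_intertwines[OF c h h]) (simp add: h_def s mult.assoc)
  have kk: "k * k = R + 1" "d * d = 1 / (R + 1)" using le c R by (simp_all add: k_def d_def)
  have "d *\<^sub>R (d *\<^sub>R x + v * x) + v * (d *\<^sub>R x + v * x) = (d * d) *\<^sub>R x + ((2 * d) *\<^sub>R v + v * v) * x" for x
    unfolding scaleR_double by (simp add: algebra_simps)
  moreover have "f (f x) = (k * k) *\<^sub>R (d *\<^sub>R (d *\<^sub>R x + v * x) + v * (d *\<^sub>R x + v * x))" for x
    by (simp add: f_def algebra_simps)
  ultimately have "f (f x) = (k * k) *\<^sub>R ((d * d) *\<^sub>R x + ((2 * d) *\<^sub>R v + v * v) * x)" for x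
    by simp
  then have ff: "f (f x) = x - a * x" for x
    unfolding v kk using le by (simp add: h_def scaleR_right_diff_distrib)
  have "norm (s * x) \<le> norm x" for x
  proof (rule norm_le_of_commuting_squares[where g = f and f = "\<lambda>x. s * x"])
    show "s * f x = f (s * x)" for x
      by (simp add: f_def distrib_left mult.assoc[symmetric] vs)
    show "star (s * x) * y = star x * (s * y)" for x y
      by (simp add: star_mult s(1) mult.assoc)
    show "star (f x) * y = star x * f y" for x y
      by (simp add: f_def star_mult star_add star_scaleR sv distrib_left distrib_right mult.assoc)
    show "s * (s * x) + f (f x) = x" for x
      by (simp add: ff s(2) mult.assoc)
  qed
  then have "norm s \<le> 1" using norm_le_if_left_mult_le[of s 1] by simp
  then show ?thesis by (simp add: s norm_selfadjoint_square power_le_one)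
qed

lemma norm_le_norm_add:
  fixes a b :: "'a::cstar_algebra"
  assumes a: "positive a" and b: "positive b"
  shows "norm a \<le> norm (a + b)"
proof (rule field_le_epsilon)
  fix e :: real assume e: "0 < e"
  define r where "r = norm (a + b) + e"
  have r: "0 < r" using e by (simp add: r_def add_nonneg_pos)
  have "norm (inverse r *\<^sub>R a) \<le> 1"
  proof (rule norm_le_1_if_le)
    have "norm (inverse r *\<^sub>R a + inverse r *\<^sub>R b) = inverse r * norm (a + b)"
      using r by (simp flip: scaleR_right_distrib)
    also have "\<dots> \<le> inverse r * r" using r e by (intro mult_left_mono) (auto simp: r_def)
    finally show "norm (inverse r *\<^sub>R a + inverse r *\<^sub>R b) \<le> 1" using r by simp
    show "norm (inverse r *\<^sub>R b) \<le> norm (inverse r *\<^sub>R b) + 1" "1 \<le> norm (inverse r *\<^sub>R b) + 1" by simp_all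
  qed (use a b r in \<open>auto intro: positive_scaleR\<close>)
  then show "norm a \<le> norm (a + b) + e" using r by (simp add: r_def field_simps)
qed

text \<open>
  If \<open>1 - w\<close> is the square root of \<open>1 - p\<close>, the element is \<open>y\<^sup>\<star>y\<close> for \<open>y = (1 - w)a\<close>.
\<close>

lemma positive_conjugate_defect:
  fixes p a :: "'a::cstar_algebra"
  assumes "positive p" "norm p \<le> 1"
  shows "positive (star a * a - star a * p * a)"
proof -
  obtain w where w: "star w = w" "w + w - w * w = p"
    using ex_one_minus_root[OF star_positive] assms by metis
  have "star a * a - star a * p * a = star (a - w * a) * (a - w * a)"
    unfolding w(2)[symmetric] by (simp add: star_diff star_mult w(1) algebra_simps)
  then show ?thesis by (auto simp: positive_def)
qed

lemma positive_add_eq_0: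
  fixes a b :: "'a::cstar_algebra"
  assumes "positive a" "positive b" "a + b = 0"
  shows "a = 0"
  using norm_le_norm_add[OF assms(1,2)] assms(3) by simp

section \<open>Hilbert modules\<close>

context hilbert_module
begin

lemma smult_carrier [simp]: "x \<in> carrier E \<Longrightarrow> c \<odot> x \<in> carrier E"
  by (simp add: ring_of_type_algebra_def)

declare ract_closed [simp]

lemma ip_add_left:
  "x \<in> carrier E \<Longrightarrow> y \<in> carrier E \<Longrightarrow> z \<in> carrier E \<Longrightarrow> \<langle>x \<oplus> y, z\<rangle> = \<langle>x, z\<rangle> + \<langle>y, z\<rangle>"
  using ip_add_right[of z x y] by (metis M.add.m_closed ip_star star_add)

lemma ip_zero_right [simp]: "x \<in> carrier E \<Longrightarrow> \<langle>x, \<zero>\<rangle> = 0"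
  using ip_add_right[of x \<zero> \<zero>] by simp

lemma ip_zero_left [simp]: "x \<in> carrier E \<Longrightarrow> \<langle>\<zero>, x\<rangle> = 0"
  using ip_add_left[of \<zero> \<zero> x] by simp

lemma ip_minus_right: "x \<in> carrier E \<Longrightarrow> y \<in> carrier E \<Longrightarrow> \<langle>x, \<ominus> y\<rangle> = - \<langle>x, y\<rangle>"
  using ip_add_right[of x y "\<ominus> y"] by (simp add: M.r_neg eq_neg_iff_add_eq_0 add.commute)

lemma ip_minus_left: "x \<in> carrier E \<Longrightarrow> y \<in> carrier E \<Longrightarrow> \<langle>\<ominus> x, y\<rangle> = - \<langle>x, y\<rangle>"
  using ip_add_left[of x "\<ominus> x" y] by (simp add: M.r_neg eq_neg_iff_add_eq_0 add.commute)

lemma ip_diff_right: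
  "x \<in> carrier E \<Longrightarrow> y \<in> carrier E \<Longrightarrow> z \<in> carrier E \<Longrightarrow> \<langle>x, y \<ominus> z\<rangle> = \<langle>x, y\<rangle> - \<langle>x, z\<rangle>"
  by (simp add: M.minus_eq ip_add_right ip_minus_right)

lemma ip_diff_left:
  "x \<in> carrier E \<Longrightarrow> y \<in> carrier E \<Longrightarrow> z \<in> carrier E \<Longrightarrow> \<langle>x \<ominus> y, z\<rangle> = \<langle>x, z\<rangle> - \<langle>y, z\<rangle>"
  by (simp add: M.minus_eq ip_add_left ip_minus_left)

lemma ip_smult_left:
  "x \<in> carrier E \<Longrightarrow> y \<in> carrier E \<Longrightarrow> \<langle>c \<odot> x, y\<rangle> = scaleC (cnj c) (\<langle>x, y\<rangle>)"
  by (metis ip_smult_right ip_star smult_carrier star_scaleC)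

lemma ip_ract_left:
  "x \<in> carrier E \<Longrightarrow> y \<in> carrier E \<Longrightarrow> \<langle>x \<triangleleft> a, y\<rangle> = star a * \<langle>x, y\<rangle>"
  by (metis ip_ract_right ip_star ract_closed star_mult)

lemmas ip_simps = ip_add_right ip_add_left ip_minus_right ip_minus_left ip_diff_right ip_diff_left
  ip_smult_right ip_smult_left ip_ract_right ip_ract_left

lemma eq_if_diff_eq_zero:
  "x \<in> carrier E \<Longrightarrow> y \<in> carrier E \<Longrightarrow> x \<ominus> y = \<zero> \<Longrightarrow> x = y"
  by (simp add: M.minus_eq M.add.inv_solve_right')

text \<open>
  Identities between vectors are verified by pairing both sides with an arbitrary vector; this moves the
  computation into the C*-algebra, where the simplifier is effective.
\<close>

lemma vector_eqI:
  assumes "x \<in> carrier E" "y \<in> carrier E" "\<And>z. z \<in> carrier E \<Longrightarrow> \<langle>z, x\<rangle> = \<langle>z, y\<rangle>"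
  shows "x = y"
proof -
  have "\<langle>x \<ominus> y, x \<ominus> y\<rangle> = 0" using assms by (simp add: ip_diff_right)
  then have "x \<ominus> y = \<zero>" using assms(1,2) ip_definite by simp
  then show ?thesis using assms(1,2) eq_if_diff_eq_zero by blast
qed

lemma smult_zero: "x \<in> carrier E \<Longrightarrow> 0 \<odot> x = \<zero>"
  by (rule vector_eqI) (simp_all add: ip_simps)

lemma smult_add_left: "x \<in> carrier E \<Longrightarrow> (c + d) \<odot> x = c \<odot> x \<oplus> d \<odot> x"
  by (rule vector_eqI) (simp_all add: ip_simps scaleC_add_left)

lemma smult_add_right:
  "x \<in> carrier E \<Longrightarrow> y \<in> carrier E \<Longrightarrow> c \<odot> (x \<oplus> y) = c \<odot> x \<oplus> c \<odot> y"
  by (rule vector_eqI) (simp_all add: ip_simps scaleC_add_right)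

lemma smult_smult: "x \<in> carrier E \<Longrightarrow> (c * d) \<odot> x = c \<odot> (d \<odot> x)"
  by (rule vector_eqI) (simp_all add: ip_simps scaleC_scaleC)

lemma smult_1: "x \<in> carrier E \<Longrightarrow> 1 \<odot> x = x"
  by (rule vector_eqI) (simp_all add: ip_simps)

lemma uminus_eq_smult: "x \<in> carrier E \<Longrightarrow> \<ominus> x = (- 1) \<odot> x"
  by (rule vector_eqI) (simp_all add: ip_simps scaleC_minus_left)

lemma hnorm_nonneg [simp]: "0 \<le> hnorm E x"
  by (simp add: hnorm_def)

lemma hnorm_power2: "(hnorm E x)\<^sup>2 = norm (\<langle>x, x\<rangle>)"
  by (simp add: hnorm_def)

lemma hnorm_zero [simp]: "hnorm E \<zero> = 0"
  by (simp add: hnorm_def)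

lemma hnorm_eq_zero_iff: "x \<in> carrier E \<Longrightarrow> hnorm E x = 0 \<longleftrightarrow> x = \<zero>"
  using ip_definite by (auto simp: hnorm_def)

text \<open>
  The Cauchy-Schwarz inequality. After normalizing \<open>x\<close> and with \<open>a = \<langle>x, y\<rangle>\<close>, the element \<open>\<langle>y, y\<rangle>\<close> exceeds \<open>a\<^sup>\<star>a\<close> by
  the sum of \<open>\<langle>xa - y, xa - y\<rangle>\<close> and \<open>a\<^sup>\<star>a - a\<^sup>\<star>\<langle>x, x\<rangle>a\<close>, which are both positive.
\<close>

lemma norm_ip_le:
  assumes x: "x \<in> carrier E" and y: "y \<in> carrier E"
  shows "norm (\<langle>x, y\<rangle>) \<le> hnorm E x * hnorm E y"
proof (cases "x = \<zero>")
  case False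
  define r where "r = hnorm E x"
  have r: "0 < r" using False x hnorm_eq_zero_iff[of x] hnorm_nonneg[of x] unfolding r_def by linarith
  define a where "a = inverse r *\<^sub>R \<langle>x, y\<rangle>"
  define p where "p = inverse (r\<^sup>2) *\<^sub>R \<langle>x, x\<rangle>"
  define z where "z = x \<triangleleft> (inverse r *\<^sub>R a) \<ominus> y"
  have z: "z \<in> carrier E" using x y by (simp add: z_def)
  have p: "positive p" "norm p \<le> 1"
    using r x ip_positive by (simp_all add: p_def positive_scaleR hnorm_power2[symmetric] r_def)
  have yx: "\<langle>y, x\<rangle> = r *\<^sub>R star a" "\<langle>x, y\<rangle> = r *\<^sub>R a" "\<langle>x, x\<rangle> = (r\<^sup>2) *\<^sub>R p"
    using r x y by (simp_all add: a_def star_scaleR ip_star p_def)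
  have "\<langle>z, z\<rangle> = star a * p * a - star a * a - star a * a + \<langle>y, y\<rangle>"
    using x y r by (simp add: z_def ip_simps yx star_scaleR power2_eq_square algebra_simps)
  then have "\<langle>y, y\<rangle> = star a * a + ((star a * a - star a * p * a) + \<langle>z, z\<rangle>)"
    by (simp add: algebra_simps)
  moreover have "norm (star a * a) \<le> norm (star a * a + ((star a * a - star a * p * a) + \<langle>z, z\<rangle>))"
    by (intro norm_le_norm_add positive_add positive_conjugate_defect p ip_positive z)
       (auto simp: positive_def)
  ultimately have "(norm a)\<^sup>2 \<le> (hnorm E y)\<^sup>2" by (simp add: cstar_identity hnorm_power2)
  then have "norm a \<le> hnorm E y" by (rule power2_le_imp_le) simp
  moreover have "norm a = norm (\<langle>x, y\<rangle>) / r" using r by (simp add: a_def field_simps)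
  ultimately show ?thesis using r by (simp add: divide_le_eq mult.commute r_def[symmetric])
qed (use y in simp)

lemma hnorm_triangle:
  assumes x: "x \<in> carrier E" and y: "y \<in> carrier E"
  shows "hnorm E (x \<oplus> y) \<le> hnorm E x + hnorm E y"
proof (rule power2_le_imp_le)
  have "\<langle>x \<oplus> y, x \<oplus> y\<rangle> = (\<langle>x, x\<rangle> + \<langle>x, y\<rangle>) + (\<langle>y, x\<rangle> + \<langle>y, y\<rangle>)"
    using x y by (simp add: ip_simps)
  then have "norm (\<langle>x \<oplus> y, x \<oplus> y\<rangle>) \<le> (norm (\<langle>x, x\<rangle>) + norm (\<langle>x, y\<rangle>)) + (norm (\<langle>y, x\<rangle>) + norm (\<langle>y, y\<rangle>))"
    by (metis add_mono norm_triangle_le norm_triangle_ineq)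
  also have "\<dots> \<le> ((hnorm E x)\<^sup>2 + hnorm E x * hnorm E y) + (hnorm E y * hnorm E x + (hnorm E y)\<^sup>2)"
    unfolding hnorm_power2 by (intro add_mono norm_ip_le x y order_refl)
  also have "\<dots> = (hnorm E x + hnorm E y)\<^sup>2" by (simp add: power2_eq_square algebra_simps)
  finally show "(hnorm E (x \<oplus> y))\<^sup>2 \<le> (hnorm E x + hnorm E y)\<^sup>2" by (simp add: hnorm_power2)
qed simp

lemma hnorm_minus: "x \<in> carrier E \<Longrightarrow> hnorm E (\<ominus> x) = hnorm E x"
  by (simp add: hnorm_def ip_simps)

lemma hdist_nonneg [simp]: "0 \<le> hdist E x y"
  by (simp add: hdist_def)

lemma hdist_commute:
  assumes "x \<in> carrier E" "y \<in> carrier E"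
  shows "hdist E x y = hdist E y x"
proof -
  have "x \<ominus> y = \<ominus> (y \<ominus> x)" by (rule vector_eqI) (simp_all add: assms ip_simps)
  then show ?thesis using assms by (simp add: hdist_def hnorm_minus)
qed

lemma hdist_triangle:
  assumes "x \<in> carrier E" "y \<in> carrier E" "z \<in> carrier E"
  shows "hdist E x z \<le> hdist E x y + hdist E y z"
proof -
  have "x \<ominus> z = (x \<ominus> y) \<oplus> (y \<ominus> z)" by (rule vector_eqI) (simp_all add: assms ip_simps)
  then show ?thesis using assms by (simp add: hdist_def hnorm_triangle)
qed

lemma hdist_self [simp]: "x \<in> carrier E \<Longrightarrow> hdist E x x = 0"
  by (simp add: hdist_def M.minus_eq M.r_neg)

lemma hlimit_hcauchy:
  assumes lim: "hlimit E u x" and u: "\<And>n. u n \<in> carrier E" and x: "x \<in> carrier E"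
  shows "hcauchy E u"
  unfolding hcauchy_def
proof (intro allI impI)
  fix e :: real assume "0 < e"
  then have "0 < e / 2" by simp
  then obtain M where M: "\<And>n. n \<ge> M \<Longrightarrow> hdist E (u n) x < e / 2"
    using lim unfolding hlimit_def LIMSEQ_iff by fastforce
  have "hdist E (u m) (u n) < e" if "m \<ge> M" "n \<ge> M" for m n
    using hdist_triangle[OF u[of m] x u[of n]] M[OF that(1)] M[OF that(2)]
      hdist_commute[OF x u[of n]] by simp
  then show "\<exists>M. \<forall>m\<ge>M. \<forall>n\<ge>M. hdist E (u m) (u n) < e" by blast
qed

lemma hlimit_ip:
  assumes lim: "hlimit E u x" and u: "\<And>n. u n \<in> carrier E" and x: "x \<in> carrier E" and z: "z \<in> carrier E"
  shows "(\<lambda>n. \<langle>z, u n\<rangle>) \<longlonglongrightarrow> \<langle>z, x\<rangle>"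
proof -
  have "(\<lambda>n. \<langle>z, u n\<rangle> - \<langle>z, x\<rangle>) \<longlonglongrightarrow> 0"
  proof (rule Lim_null_comparison)
    show "\<forall>\<^sub>F n in sequentially. norm (\<langle>z, u n\<rangle> - \<langle>z, x\<rangle>) \<le> hnorm E z * hdist E (u n) x"
      using norm_ip_le[OF z M.minus_closed[OF u x]] u x z by (simp add: ip_diff_right hdist_def)
    show "(\<lambda>n. hnorm E z * hdist E (u n) x) \<longlonglongrightarrow> 0"
      using tendsto_mult_right_zero[OF lim[unfolded hlimit_def]] .
  qed
  then show ?thesis by (simp add: LIM_zero_iff)
qed

lemma orthogonal_to_dense:
  assumes S: "hdense E S" and z: "z \<in> carrier E" and orth: "\<And>x. x \<in> S \<Longrightarrow> \<langle>x, z\<rangle> = 0"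
  shows "z = \<zero>"
proof -
  have "hnorm E z \<le> 0 + e" if "0 < e" for e
  proof -
    obtain x where x: "x \<in> S" "hdist E z x < e" using S z \<open>0 < e\<close> unfolding hdense_def by blast
    have xc: "x \<in> carrier E" using S x unfolding hdense_def by blast
    have "hnorm E z * hnorm E z = norm (\<langle>z \<ominus> x, z\<rangle>)"
      using z xc orth[OF x(1)] hnorm_power2[of z] by (simp add: ip_diff_left power2_eq_square)
    also have "\<dots> \<le> hdist E z x * hnorm E z"
      using norm_ip_le[of "z \<ominus> x" z] z xc by (simp add: hdist_def)
    also have "\<dots> \<le> e * hnorm E z" using x by (intro mult_right_mono) auto
    finally show ?thesis using that hnorm_nonneg[of z]
      by (metis add_0 less_eq_real_def mult_le_cancel_right linorder_not_le)
  qed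
  then have "hnorm E z \<le> 0" by (rule field_le_epsilon)
  then have "hnorm E z = 0" using hnorm_nonneg[of z] by linarith
  then show ?thesis using hnorm_eq_zero_iff z by simp
qed

lemma hdense_eqI:
  assumes "hdense E S" "y \<in> carrier E" "z \<in> carrier E" "\<And>x. x \<in> S \<Longrightarrow> \<langle>x, y\<rangle> = \<langle>x, z\<rangle>"
  shows "y = z"
proof -
  have "y \<ominus> z = \<zero>"
  proof (rule orthogonal_to_dense[OF assms(1)])
    fix x assume x: "x \<in> S"
    then have "x \<in> carrier E" using assms(1) unfolding hdense_def by blast
    then show "\<langle>x, y \<ominus> z\<rangle> = 0" using assms x by (simp add: ip_diff_right)
  qed (use assms in simp)
  then show ?thesis using assms(2,3) eq_if_diff_eq_zero by blast
qed

end

lemma closed_operatorD: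
  assumes "closed_operator E F t" "\<And>n. t (u n) = Some (w n)" "x \<in> carrier E" "y \<in> carrier F"
    "hlimit E u x" "hlimit F w y"
  shows "t x = Some y"
proof -
  have "(\<lambda>n. the (t (u n))) = w" using assms(2) by auto
  moreover have "\<forall>n. u n \<in> dom t" using assms(2) by auto
  ultimately show ?thesis
    using assms(1,3-6) unfolding closed_operator_def by metis
qed

section \<open>Formally adjoint operators\<close>

text \<open>
  The graph formulation of linearity over the scalars and over the C*-algebra. It applies to
  partial functions whose domain is not yet known to be dense.
\<close>

definition linear_operator ::
  "('a::cstar_algebra, 'e) hmodule \<Rightarrow> ('a, 'f) hmodule \<Rightarrow> ('e \<rightharpoonup> 'f) \<Rightarrow> bool" where
  "linear_operator E F t \<longleftrightarrow>
     t \<zero>\<^bsub>E\<^esub> = Some \<zero>\<^bsub>F\<^esub> \<and>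
     (\<forall>x y. t x = Some y \<longrightarrow> x \<in> carrier E \<and> y \<in> carrier F) \<and>
     (\<forall>x y x' y'. t x = Some y \<longrightarrow> t x' = Some y' \<longrightarrow> t (x \<oplus>\<^bsub>E\<^esub> x') = Some (y \<oplus>\<^bsub>F\<^esub> y')) \<and>
     (\<forall>c x y. t x = Some y \<longrightarrow> t (c \<odot>\<^bsub>E\<^esub> x) = Some (c \<odot>\<^bsub>F\<^esub> y)) \<and>
     (\<forall>a x y. t x = Some y \<longrightarrow> t (x \<triangleleft>\<^bsub>E\<^esub> a) = Some (y \<triangleleft>\<^bsub>F\<^esub> a))"

text \<open>
  Surjectivity of \<open>1 + st\<close>, with witnesses for the intermediate values, so that no composition of partial
  functions has to be unfolded.
\<close>

definition surjective_one_plus ::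
  "('a::cstar_algebra, 'e) hmodule \<Rightarrow> ('e \<rightharpoonup> 'f) \<Rightarrow> ('f \<rightharpoonup> 'e) \<Rightarrow> bool" where
  "surjective_one_plus E t s \<longleftrightarrow>
     (\<forall>x\<in>carrier E. \<exists>p q r. t p = Some q \<and> s q = Some r \<and> x = p \<oplus>\<^bsub>E\<^esub> r)"

locale formal_adjoints =
  E: hilbert_module E + F: hilbert_module F
  for E :: "('a::cstar_algebra, 'e) hmodule" and F :: "('a, 'f) hmodule" +
  fixes t :: "'e \<rightharpoonup> 'f" and s :: "'f \<rightharpoonup> 'e"
  assumes t: "linear_operator E F t" and s: "linear_operator F E s"
    and adjoint: "t x = Some y \<Longrightarrow> s v = Some w \<Longrightarrow> \<langle>y, v\<rangle>\<^bsub>F\<^esub> = \<langle>x, w\<rangle>\<^bsub>E\<^esub>"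
begin

lemma t_carrier: "t x = Some y \<Longrightarrow> x \<in> carrier E" "t x = Some y \<Longrightarrow> y \<in> carrier F"
  using t by (auto simp: linear_operator_def)

lemma s_carrier: "s x = Some y \<Longrightarrow> x \<in> carrier F" "s x = Some y \<Longrightarrow> y \<in> carrier E"
  using s by (auto simp: linear_operator_def)

lemma t_add: "t x = Some y \<Longrightarrow> t x' = Some y' \<Longrightarrow> t (x \<oplus>\<^bsub>E\<^esub> x') = Some (y \<oplus>\<^bsub>F\<^esub> y')"
  using t unfolding linear_operator_def by metis

lemma s_add: "s x = Some y \<Longrightarrow> s x' = Some y' \<Longrightarrow> s (x \<oplus>\<^bsub>F\<^esub> x') = Some (y \<oplus>\<^bsub>E\<^esub> y')"
  using s unfolding linear_operator_def by metis

lemma t_diff: "t x = Some y \<Longrightarrow> t x' = Some y' \<Longrightarrow> t (x \<ominus>\<^bsub>E\<^esub> x') = Some (y \<ominus>\<^bsub>F\<^esub> y')"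
  using t t_carrier unfolding linear_operator_def E.M.minus_eq F.M.minus_eq
  by (metis E.uminus_eq_smult F.uminus_eq_smult)

lemma s_diff: "s x = Some y \<Longrightarrow> s x' = Some y' \<Longrightarrow> s (x \<ominus>\<^bsub>F\<^esub> x') = Some (y \<ominus>\<^bsub>E\<^esub> y')"
  using s s_carrier unfolding linear_operator_def E.M.minus_eq F.M.minus_eq
  by (metis E.uminus_eq_smult F.uminus_eq_smult)

lemma adjoint': "t x = Some y \<Longrightarrow> s v = Some w \<Longrightarrow> \<langle>v, y\<rangle>\<^bsub>F\<^esub> = \<langle>w, x\<rangle>\<^bsub>E\<^esub>"
  using adjoint[of x y v w] by (metis E.ip_star F.ip_star s_carrier t_carrier)

lemma swap: "formal_adjoints F E s t"
  by unfold_locales (auto simp: t s adjoint')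

text \<open>
  Both bounds come from \<open>\<langle>p, p + r\<rangle> = \<langle>p, p\<rangle> + \<langle>q, q\<rangle>\<close>, where \<open>q = tp\<close> and \<open>r = sq\<close>, by the Cauchy-Schwarz
  inequality.
\<close>

lemma one_plus_bounds:
  assumes "t p = Some q" "s q = Some r"
  shows "hnorm E p \<le> hnorm E (p \<oplus>\<^bsub>E\<^esub> r)" "hnorm F q \<le> hnorm E (p \<oplus>\<^bsub>E\<^esub> r)"
proof -
  note c = t_carrier[OF assms(1)] s_carrier[OF assms(2)]
  let ?u = "p \<oplus>\<^bsub>E\<^esub> r"
  have eq: "\<langle>p, ?u\<rangle>\<^bsub>E\<^esub> = \<langle>p, p\<rangle>\<^bsub>E\<^esub> + \<langle>q, q\<rangle>\<^bsub>F\<^esub>"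
    using c adjoint[OF assms] by (simp add: E.ip_simps)
  have le: "norm (\<langle>p, ?u\<rangle>\<^bsub>E\<^esub>) \<le> hnorm E p * hnorm E ?u" using c by (simp add: E.norm_ip_le)
  have "norm (\<langle>p, p\<rangle>\<^bsub>E\<^esub>) \<le> norm (\<langle>p, ?u\<rangle>\<^bsub>E\<^esub>)"
    unfolding eq using c by (intro norm_le_norm_add E.ip_positive F.ip_positive)
  with le have "hnorm E p * hnorm E p \<le> hnorm E p * hnorm E ?u"
    by (simp add: E.hnorm_power2[symmetric] power2_eq_square)
  then show 1: "hnorm E p \<le> hnorm E ?u"
    using E.hnorm_nonneg by (metis mult_le_cancel_left_pos order_le_less)
  have "norm (\<langle>q, q\<rangle>\<^bsub>F\<^esub>) \<le> norm (\<langle>p, ?u\<rangle>\<^bsub>E\<^esub>)"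
    unfolding eq add.commute[of "\<langle>p, p\<rangle>\<^bsub>E\<^esub>"] using c by (intro norm_le_norm_add E.ip_positive F.ip_positive)
  also have "\<dots> \<le> hnorm E ?u * hnorm E ?u"
    using order_trans[OF le mult_right_mono[OF 1]] by simp
  finally have "(hnorm F q)\<^sup>2 \<le> (hnorm E ?u)\<^sup>2"
    by (simp only: F.hnorm_power2 power2_eq_square[of "hnorm E ?u"])
  then show "hnorm F q \<le> hnorm E ?u" by (rule power2_le_imp_le) simp
qed

text \<open>
  If \<open>(1 + st)p\<^sub>n\<close> converges, then by the preceding bounds so do \<open>p\<^sub>n\<close> and \<open>tp\<^sub>n\<close>, and therefore also
  \<open>stp\<^sub>n\<close>; the closedness of \<open>t\<close> and \<open>s\<close> identifies the limits.
\<close>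

lemma surjective_if_dense_range:
  assumes "closed_operator E F t" "closed_operator F E s"
    and dense: "\<And>x e. x \<in> carrier E \<Longrightarrow> 0 < e \<Longrightarrow>
      \<exists>p q r. t p = Some q \<and> s q = Some r \<and> hdist E x (p \<oplus>\<^bsub>E\<^esub> r) < e"
  shows "surjective_one_plus E t s"
  unfolding surjective_one_plus_def
proof
  fix x assume x: "x \<in> carrier E"
  have "\<exists>p q r. t p = Some q \<and> s q = Some r \<and> hdist E x (p \<oplus>\<^bsub>E\<^esub> r) < inverse (real (Suc n))" for n
    using dense[OF x] by simp
  then obtain p q r where pqr: "\<And>n. t (p n) = Some (q n)" "\<And>n. s (q n) = Some (r n)"
      "\<And>n. hdist E x (p n \<oplus>\<^bsub>E\<^esub> r n) < inverse (real (Suc n))"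
    by metis
  note c = t_carrier[OF pqr(1)] s_carrier[OF pqr(2)]
  define u where "u n = p n \<oplus>\<^bsub>E\<^esub> r n" for n
  have u: "u n \<in> carrier E" for n by (simp add: u_def c)
  have "(\<lambda>n. hdist E (u n) x) \<longlonglongrightarrow> 0"
  proof (rule Lim_null_comparison[OF _ LIMSEQ_inverse_real_of_nat])
    show "\<forall>\<^sub>F n in sequentially. norm (hdist E (u n) x) \<le> inverse (real (Suc n))"
      using pqr(3) x u E.hdist_commute[of x] by (simp add: u_def less_imp_le)
  qed
  then have lim_u: "hlimit E u x" by (simp add: hlimit_def)
  have cauchy: "hcauchy E u" by (rule E.hlimit_hcauchy[OF lim_u u x])
  have diff: "hdist E (p m) (p n) \<le> hdist E (u m) (u n)" "hdist F (q m) (q n) \<le> hdist E (u m) (u n)" for m n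
  proof -
    have "u m \<ominus>\<^bsub>E\<^esub> u n = (p m \<ominus>\<^bsub>E\<^esub> p n) \<oplus>\<^bsub>E\<^esub> (r m \<ominus>\<^bsub>E\<^esub> r n)"
      by (rule E.vector_eqI) (simp_all add: u_def c E.ip_simps)
    then show "hdist E (p m) (p n) \<le> hdist E (u m) (u n)" "hdist F (q m) (q n) \<le> hdist E (u m) (u n)"
      using one_plus_bounds[OF t_diff[OF pqr(1) pqr(1)] s_diff[OF pqr(2) pqr(2)], of m n]
      by (simp_all add: hdist_def)
  qed
  have "hcauchy E p" "hcauchy F q"
    using cauchy diff unfolding hcauchy_def by (meson le_less_trans)+
  then obtain P Q where P: "P \<in> carrier E" "hlimit E p P" and Q: "Q \<in> carrier F" "hlimit F q Q"
    using E.complete F.complete c by meson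
  have "t P = Some Q"
    by (rule closed_operatorD[OF assms(1) pqr(1) P(1) Q(1) P(2) Q(2)])
  moreover have "hlimit E r (x \<ominus>\<^bsub>E\<^esub> P)"
  proof -
    have "hdist E (r n) (x \<ominus>\<^bsub>E\<^esub> P) \<le> hdist E (u n) x + hdist E (p n) P" for n
    proof -
      have "r n \<ominus>\<^bsub>E\<^esub> (x \<ominus>\<^bsub>E\<^esub> P) = (u n \<ominus>\<^bsub>E\<^esub> x) \<oplus>\<^bsub>E\<^esub> \<ominus>\<^bsub>E\<^esub> (p n \<ominus>\<^bsub>E\<^esub> P)"
        by (rule E.vector_eqI) (simp_all add: u_def c x P E.ip_simps)
      then show ?thesis
        using E.hnorm_triangle[of "u n \<ominus>\<^bsub>E\<^esub> x" "\<ominus>\<^bsub>E\<^esub> (p n \<ominus>\<^bsub>E\<^esub> P)"] u x P c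
        by (simp add: hdist_def E.hnorm_minus)
    qed
    moreover have lim: "(\<lambda>n. hdist E (u n) x + hdist E (p n) P) \<longlonglongrightarrow> 0"
      using tendsto_add[OF lim_u[unfolded hlimit_def] P(2)[unfolded hlimit_def]] by simp
    ultimately show ?thesis unfolding hlimit_def
      by (intro Lim_null_comparison[OF _ lim]) simp
  qed
  then have "s Q = Some (x \<ominus>\<^bsub>E\<^esub> P)"
    by (rule closed_operatorD[OF assms(2) pqr(2) Q(1) _ Q(2), rotated]) (simp add: x P)
  moreover have "x = P \<oplus>\<^bsub>E\<^esub> (x \<ominus>\<^bsub>E\<^esub> P)"
    by (rule E.vector_eqI) (simp_all add: x P E.ip_simps)
  ultimately show "\<exists>p q r. t p = Some q \<and> s q = Some r \<and> x = p \<oplus>\<^bsub>E\<^esub> r" by blast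
qed

text \<open>
  For \<open>v\<close> in the domain of \<open>s\<close>, solve \<open>p + stp = sv\<close>. Then \<open>s(v - tp) = p\<close>, so that \<open>v - tp\<close> is mapped to
  \<open>v\<close> by \<open>1 + ts\<close>. Thus the range of \<open>1 + ts\<close> contains the dense domain of \<open>s\<close>.
\<close>

lemma surjective_swap:
  assumes "closed_operator E F t" "closed_operator F E s"
    and surj: "surjective_one_plus E t s" and dense: "hdense F (dom s)"
  shows "surjective_one_plus F s t"
proof -
  interpret sw: formal_adjoints F E s t by (rule swap)
  show ?thesis
  proof (rule sw.surjective_if_dense_range[OF assms(2,1)])
    fix x and e :: real assume "x \<in> carrier F" "0 < e"
    then obtain v where v: "v \<in> dom s" "hdist F x v < e" using dense unfolding hdense_def by blast
    then obtain w where w: "s v = Some w" by blast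
    then obtain p q r where pqr: "t p = Some q" "s q = Some r" "w = p \<oplus>\<^bsub>E\<^esub> r"
      using surj s_carrier unfolding surjective_one_plus_def by blast
    note c = t_carrier[OF pqr(1)] s_carrier[OF pqr(2)] s_carrier[OF w]
    have "w \<ominus>\<^bsub>E\<^esub> r = p" by (rule E.vector_eqI) (simp_all add: pqr(3) c E.ip_simps)
    then have "s (v \<ominus>\<^bsub>F\<^esub> q) = Some p" using s_diff[OF w pqr(2)] by simp
    moreover have "(v \<ominus>\<^bsub>F\<^esub> q) \<oplus>\<^bsub>F\<^esub> q = v" by (rule F.vector_eqI) (simp_all add: c F.ip_simps)
    ultimately show "\<exists>p q r. s p = Some q \<and> t q = Some r \<and> hdist F x (p \<oplus>\<^bsub>F\<^esub> r) < e"
      using pqr(1) v(2) by metis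
  qed
qed

text \<open>
  Let \<open>P\<close> be the inverse of \<open>1 + st\<close>. The vectors \<open>z\<^sub>n = (1 - P)\<^sup>n x\<close> differ from \<open>x\<close> by elements of the
  range of \<open>P\<close>, which is the domain of \<open>st\<close>, so it suffices that \<open>z\<^sub>n\<close> tends to \<open>0\<close>. Put \<open>a\<^sub>n = tz\<^sub>n\<close>. Then
  \<open>\<langle>a\<^sub>n, a\<^sub>n\<rangle> - \<langle>a\<^sub>n\<^sub>+\<^sub>1, a\<^sub>n\<^sub>+\<^sub>1\<rangle> \<ge> 2\<langle>z\<^sub>n\<^sub>+\<^sub>1, z\<^sub>n\<^sub>+\<^sub>1\<rangle>\<close> while \<open>\<langle>z\<^sub>n, z\<^sub>n\<rangle>\<close> decreases, and summing up gives
  \<open>n\<langle>z\<^sub>n, z\<^sub>n\<rangle> \<le> \<langle>tx, tx\<rangle>\<close>.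
\<close>

lemma dense_core:
  assumes surj: "surjective_one_plus E t s" and x: "t x = Some y" and e: "0 < e"
  shows "\<exists>p q r. t p = Some q \<and> s q = Some r \<and> hdist E x p < e"
proof -
  have step: "\<exists>z a q r. t z = Some a \<and> t (x \<ominus>\<^bsub>E\<^esub> z) = Some q \<and> s q = Some r \<and>
      positive (\<langle>y, y\<rangle>\<^bsub>F\<^esub> - \<langle>a, a\<rangle>\<^bsub>F\<^esub> - real n *\<^sub>R \<langle>z, z\<rangle>\<^bsub>E\<^esub>)" for n
  proof (induction n)
    case 0
    have "x \<ominus>\<^bsub>E\<^esub> x = \<zero>\<^bsub>E\<^esub>" by (rule E.vector_eqI) (simp_all add: t_carrier[OF x] E.ip_simps)
    then show ?case using x t s unfolding linear_operator_def
      by (intro exI[of _ x] exI[of _ y] exI[of _ "\<zero>\<^bsub>F\<^esub>"] exI[of _ "\<zero>\<^bsub>E\<^esub>"]) simp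
  next
    case (Suc n)
    then obtain z a q' r' where z: "t z = Some a" and qr': "t (x \<ominus>\<^bsub>E\<^esub> z) = Some q'" "s q' = Some r'"
      and pos: "positive (\<langle>y, y\<rangle>\<^bsub>F\<^esub> - \<langle>a, a\<rangle>\<^bsub>F\<^esub> - real n *\<^sub>R \<langle>z, z\<rangle>\<^bsub>E\<^esub>)" by blast
    \<comment> \<open>here p is P applied to z, and r = z - p is the next iterate\<close>
    obtain p q r where pqr: "t p = Some q" "s q = Some r" "z = p \<oplus>\<^bsub>E\<^esub> r"
      using surj t_carrier[OF z] unfolding surjective_one_plus_def by blast
    note c = t_carrier[OF pqr(1)] s_carrier[OF pqr(2)] t_carrier[OF z] t_carrier[OF x]
      t_carrier[OF qr'(1)] s_carrier[OF qr'(2)]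
    have "z \<ominus>\<^bsub>E\<^esub> p = r" by (rule E.vector_eqI) (simp_all add: pqr(3) c E.ip_simps)
    then have tr: "t r = Some (a \<ominus>\<^bsub>F\<^esub> q)" using t_diff[OF z pqr(1)] by simp
    have "(x \<ominus>\<^bsub>E\<^esub> z) \<oplus>\<^bsub>E\<^esub> p = x \<ominus>\<^bsub>E\<^esub> r"
      by (rule E.vector_eqI) (simp_all add: pqr(3) c E.ip_simps)
    then have dom: "t (x \<ominus>\<^bsub>E\<^esub> r) = Some (q' \<oplus>\<^bsub>F\<^esub> q)" "s (q' \<oplus>\<^bsub>F\<^esub> q) = Some (r' \<oplus>\<^bsub>E\<^esub> r)"
      using t_add[OF qr'(1) pqr(1)] s_add[OF qr'(2) pqr(2)] by simp_all
    have 1: "\<langle>q, a\<rangle>\<^bsub>F\<^esub> = \<langle>r, z\<rangle>\<^bsub>E\<^esub>" by (rule adjoint'[OF z pqr(2)])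
    have 2: "\<langle>q, q\<rangle>\<^bsub>F\<^esub> = \<langle>r, p\<rangle>\<^bsub>E\<^esub>" "\<langle>q, q\<rangle>\<^bsub>F\<^esub> = \<langle>p, r\<rangle>\<^bsub>E\<^esub>"
      by (rule adjoint'[OF pqr(1,2)], rule adjoint[OF pqr(1,2)])
    have 3: "\<langle>a \<ominus>\<^bsub>F\<^esub> q, q\<rangle>\<^bsub>F\<^esub> = \<langle>r, r\<rangle>\<^bsub>E\<^esub>" by (rule adjoint[OF tr pqr(2)])
    have rz: "\<langle>r, z\<rangle>\<^bsub>E\<^esub> = \<langle>q, q\<rangle>\<^bsub>F\<^esub> + \<langle>r, r\<rangle>\<^bsub>E\<^esub>" using c 2 by (simp add: pqr(3) E.ip_simps)
    have zz: "\<langle>z, z\<rangle>\<^bsub>E\<^esub> = \<langle>p, p\<rangle>\<^bsub>E\<^esub> + \<langle>q, q\<rangle>\<^bsub>F\<^esub> + \<langle>q, q\<rangle>\<^bsub>F\<^esub> + \<langle>r, r\<rangle>\<^bsub>E\<^esub>"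
      using c 2 by (simp add: pqr(3) E.ip_simps add_ac)
    have aa: "\<langle>a \<ominus>\<^bsub>F\<^esub> q, a \<ominus>\<^bsub>F\<^esub> q\<rangle>\<^bsub>F\<^esub> = \<langle>a, a\<rangle>\<^bsub>F\<^esub> - \<langle>q, a\<rangle>\<^bsub>F\<^esub> - \<langle>a \<ominus>\<^bsub>F\<^esub> q, q\<rangle>\<^bsub>F\<^esub>"
      using c by (simp add: F.ip_simps algebra_simps)
    have "\<langle>y, y\<rangle>\<^bsub>F\<^esub> - \<langle>a \<ominus>\<^bsub>F\<^esub> q, a \<ominus>\<^bsub>F\<^esub> q\<rangle>\<^bsub>F\<^esub> - real (Suc n) *\<^sub>R \<langle>r, r\<rangle>\<^bsub>E\<^esub>
        = (\<langle>y, y\<rangle>\<^bsub>F\<^esub> - \<langle>a, a\<rangle>\<^bsub>F\<^esub> - real n *\<^sub>R \<langle>z, z\<rangle>\<^bsub>E\<^esub>) + (\<langle>r, r\<rangle>\<^bsub>E\<^esub> + \<langle>q, q\<rangle>\<^bsub>F\<^esub>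
          + real n *\<^sub>R (\<langle>p, p\<rangle>\<^bsub>E\<^esub> + \<langle>q, q\<rangle>\<^bsub>F\<^esub> + \<langle>q, q\<rangle>\<^bsub>F\<^esub>))"
      unfolding aa 1 3 rz zz by (simp add: algebra_simps)
    also have "positive \<dots>"
      using c by (intro positive_add pos positive_scaleR E.ip_positive F.ip_positive) auto
    finally show ?case using tr dom by blast
  qed
  obtain n :: nat where n: "norm (\<langle>y, y\<rangle>\<^bsub>F\<^esub>) / e\<^sup>2 < real n" using reals_Archimedean2 by blast
  obtain z a q r where z: "t z = Some a" and qr: "t (x \<ominus>\<^bsub>E\<^esub> z) = Some q" "s q = Some r"
      and pos: "positive (\<langle>y, y\<rangle>\<^bsub>F\<^esub> - \<langle>a, a\<rangle>\<^bsub>F\<^esub> - real n *\<^sub>R \<langle>z, z\<rangle>\<^bsub>E\<^esub>)"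
    using step[of n] by blast
  note c = t_carrier[OF z] t_carrier[OF x]
  let ?D = "\<langle>y, y\<rangle>\<^bsub>F\<^esub> - \<langle>a, a\<rangle>\<^bsub>F\<^esub> - real n *\<^sub>R \<langle>z, z\<rangle>\<^bsub>E\<^esub>"
  have "norm (real n *\<^sub>R \<langle>z, z\<rangle>\<^bsub>E\<^esub>) \<le> norm (real n *\<^sub>R \<langle>z, z\<rangle>\<^bsub>E\<^esub> + (?D + \<langle>a, a\<rangle>\<^bsub>F\<^esub>))"
    using c by (intro norm_le_norm_add positive_add positive_scaleR E.ip_positive F.ip_positive pos) auto
  then have le: "real n * (hnorm E z)\<^sup>2 \<le> norm (\<langle>y, y\<rangle>\<^bsub>F\<^esub>)" by (simp add: E.hnorm_power2)
  also have "\<dots> < real n * e\<^sup>2" using n e by (simp add: divide_less_eq)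
  finally have "(hnorm E z)\<^sup>2 < e\<^sup>2" by (simp add: mult_less_cancel_left)
  then have "hnorm E z < e" by (rule power_less_imp_less_base) (use e in simp)
  moreover have "x \<ominus>\<^bsub>E\<^esub> (x \<ominus>\<^bsub>E\<^esub> z) = z" by (rule E.vector_eqI) (simp_all add: c E.ip_simps)
  ultimately have "hdist E x (x \<ominus>\<^bsub>E\<^esub> z) < e" by (simp add: hdist_def)
  with qr show ?thesis by blast
qed

text \<open>
  Von Neumann's argument. The surjectivity hypotheses provide \<open>d\<close> in the domain of \<open>t\<close> and \<open>v\<close> in the
  domain of \<open>s\<close> with \<open>v - td = y\<close> and \<open>d + sv = z\<close>. Testing the hypothesis on \<open>(y, z)\<close> with \<open>d\<close> gives
  \<open>\<langle>d, d\<rangle> + \<langle>td, td\<rangle> = 0\<close>, so \<open>(y, z) = (v, sv)\<close>.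
\<close>

lemma s_contains_adjoint:
  assumes surj: "surjective_one_plus E t s" "surjective_one_plus F s t"
    and y: "y \<in> carrier F" and z: "z \<in> carrier E"
    and eq: "\<And>x x'. t x = Some x' \<Longrightarrow> \<langle>x', y\<rangle>\<^bsub>F\<^esub> = \<langle>x, z\<rangle>\<^bsub>E\<^esub>"
  shows "s y = Some z"
proof -
  obtain p1 q1 r1 where 1: "t p1 = Some q1" "s q1 = Some r1" "z = p1 \<oplus>\<^bsub>E\<^esub> r1"
    using surj(1) z unfolding surjective_one_plus_def by blast
  obtain p2 q2 r2 where 2: "s p2 = Some q2" "t q2 = Some r2" "y = p2 \<oplus>\<^bsub>F\<^esub> r2"
    using surj(2) y unfolding surjective_one_plus_def by blast
  note c = t_carrier[OF 1(1)] t_carrier[OF 2(2)] s_carrier[OF 1(2)] s_carrier[OF 2(1)]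
  have x: "t (p1 \<ominus>\<^bsub>E\<^esub> q2) = Some (q1 \<ominus>\<^bsub>F\<^esub> r2)" by (rule t_diff[OF 1(1) 2(2)])
  have v: "s (p2 \<oplus>\<^bsub>F\<^esub> q1) = Some (q2 \<oplus>\<^bsub>E\<^esub> r1)" by (rule s_add[OF 2(1) 1(2)])
  define d where "d = p1 \<ominus>\<^bsub>E\<^esub> q2"
  define d' where "d' = q1 \<ominus>\<^bsub>F\<^esub> r2"
  have XC: "d \<in> carrier E" "d' \<in> carrier F" using c by (simp_all add: d_def d'_def)
  note x = x[folded d_def d'_def]
  have "\<langle>d', y\<rangle>\<^bsub>F\<^esub> = \<langle>d, z\<rangle>\<^bsub>E\<^esub>" by (rule eq[OF x])
  then have 3: "\<langle>d', p2\<rangle>\<^bsub>F\<^esub> + \<langle>d', r2\<rangle>\<^bsub>F\<^esub> = \<langle>d, p1\<rangle>\<^bsub>E\<^esub> + \<langle>d, r1\<rangle>\<^bsub>E\<^esub>"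
    using c XC by (simp add: 1(3) 2(3) E.ip_add_right F.ip_add_right)
  have "\<langle>d', p2 \<oplus>\<^bsub>F\<^esub> q1\<rangle>\<^bsub>F\<^esub> = \<langle>d, q2 \<oplus>\<^bsub>E\<^esub> r1\<rangle>\<^bsub>E\<^esub>" by (rule adjoint[OF x v])
  then have 4: "\<langle>d', p2\<rangle>\<^bsub>F\<^esub> + \<langle>d', q1\<rangle>\<^bsub>F\<^esub> = \<langle>d, q2\<rangle>\<^bsub>E\<^esub> + \<langle>d, r1\<rangle>\<^bsub>E\<^esub>"
    using c XC by (simp add: E.ip_add_right F.ip_add_right)
  have "\<langle>d, d\<rangle>\<^bsub>E\<^esub> = \<langle>d, p1\<rangle>\<^bsub>E\<^esub> - \<langle>d, q2\<rangle>\<^bsub>E\<^esub>"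
    by (subst (2) d_def) (simp add: E.ip_diff_right c XC)
  moreover have "\<langle>d', d'\<rangle>\<^bsub>F\<^esub> = \<langle>d', q1\<rangle>\<^bsub>F\<^esub> - \<langle>d', r2\<rangle>\<^bsub>F\<^esub>"
    by (subst (2) d'_def) (simp add: F.ip_diff_right c XC)
  moreover have "\<langle>d', q1\<rangle>\<^bsub>F\<^esub> - \<langle>d', r2\<rangle>\<^bsub>F\<^esub>
      = (\<langle>d', p2\<rangle>\<^bsub>F\<^esub> + \<langle>d', q1\<rangle>\<^bsub>F\<^esub>) - (\<langle>d', p2\<rangle>\<^bsub>F\<^esub> + \<langle>d', r2\<rangle>\<^bsub>F\<^esub>)" by simp
  ultimately have sum: "\<langle>d, d\<rangle>\<^bsub>E\<^esub> + \<langle>d', d'\<rangle>\<^bsub>F\<^esub> = 0"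
    unfolding 3 4 by simp
  have "\<langle>d, d\<rangle>\<^bsub>E\<^esub> = 0"
    by (rule positive_add_eq_0[OF E.ip_positive F.ip_positive sum]) (rule XC)+
  with sum have "d = \<zero>\<^bsub>E\<^esub>" "d' = \<zero>\<^bsub>F\<^esub>"
    using XC E.ip_definite F.ip_definite by auto
  then have "p1 = q2" "q1 = r2"
    using E.eq_if_diff_eq_zero[OF c(1) c(3)] F.eq_if_diff_eq_zero[OF c(2) c(4)]
    by (simp_all add: d_def d'_def)
  then show ?thesis using v by (simp add: 1(3) 2(3))
qed

end

section \<open>Adjoints and regular operators\<close>

lemma adjoint_op_eq_Some_iff:
  assumes E: "hilbert_module E" and dense: "hdense E (dom t)"
  shows "adjoint_op E F t y = Some z \<longleftrightarrow>
    y \<in> carrier F \<and> z \<in> carrier E \<and> (\<forall>x w. t x = Some w \<longrightarrow> \<langle>w, y\<rangle>\<^bsub>F\<^esub> = \<langle>x, z\<rangle>\<^bsub>E\<^esub>)"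
proof -
  interpret E: hilbert_module E by (rule E)
  define P where "P z \<longleftrightarrow> z \<in> carrier E \<and> (\<forall>x\<in>dom t. \<langle>the (t x), y\<rangle>\<^bsub>F\<^esub> = \<langle>x, z\<rangle>\<^bsub>E\<^esub>)" for z
  have P_iff: "P z \<longleftrightarrow> z \<in> carrier E \<and> (\<forall>x w. t x = Some w \<longrightarrow> \<langle>w, y\<rangle>\<^bsub>F\<^esub> = \<langle>x, z\<rangle>\<^bsub>E\<^esub>)" for z
    unfolding P_def by force
  have unique: "z = z'" if "P z" "P z'" for z z'
    by (rule E.hdense_eqI[OF dense]) (use that in \<open>auto simp: P_def\<close>)
  have the_eq: "(THE z. P z) = z" if "P z" for z
    using that unique by (intro the_equality) auto
  have "adjoint_op E F t y = (if y \<in> carrier F \<and> (\<exists>z. P z) then Some (THE z. P z) else None)"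
    unfolding adjoint_op_def P_def Let_def by (rule refl)
  then show ?thesis unfolding P_iff[symmetric] using the_eq by auto
qed

lemma linear_operator_if_densely_defined:
  assumes "densely_defined_operator E F t"
  shows "linear_operator E F t"
proof -
  interpret E: hilbert_module E using assms by (simp add: densely_defined_operator_def)
  interpret F: hilbert_module F using assms by (simp add: densely_defined_operator_def)
  have carrier: "x \<in> carrier E \<and> y \<in> carrier F" if "t x = Some y" for x y
    using assms that by (force simp: densely_defined_operator_def hdense_def ran_def)
  obtain x y where xy: "t x = Some y"
    using assms E.M.zero_closed zero_less_one unfolding densely_defined_operator_def hdense_def by blast
  have smult: "t (c \<odot>\<^bsub>E\<^esub> x) = Some (c \<odot>\<^bsub>F\<^esub> y)" if "t x = Some y" for c x y
    using assms that unfolding densely_defined_operator_def by (metis domI option.sel)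
  have "t \<zero>\<^bsub>E\<^esub> = Some \<zero>\<^bsub>F\<^esub>"
    using smult[OF xy, of 0] carrier[OF xy] by (simp add: E.smult_zero F.smult_zero)
  moreover have "t (x \<oplus>\<^bsub>E\<^esub> x') = Some (y \<oplus>\<^bsub>F\<^esub> y')" if "t x = Some y" "t x' = Some y'" for x y x' y'
    using assms that unfolding densely_defined_operator_def by (metis domI option.sel)
  moreover have "t (x \<triangleleft>\<^bsub>E\<^esub> a) = Some (y \<triangleleft>\<^bsub>F\<^esub> a)" if "t x = Some y" for a x y
    using assms that unfolding densely_defined_operator_def by (metis domI option.sel)
  ultimately show ?thesis unfolding linear_operator_def using carrier smult by blast
qed

lemma formal_adjoints_adjoint_op:
  assumes t: "densely_defined_operator E F t"
  shows "formal_adjoints E F t (adjoint_op E F t)"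
proof -
  interpret E: hilbert_module E using assms by (simp add: densely_defined_operator_def)
  interpret F: hilbert_module F using assms by (simp add: densely_defined_operator_def)
  have dense: "hdense E (dom t)" using t by (simp add: densely_defined_operator_def)
  have lin: "linear_operator E F t" by (rule linear_operator_if_densely_defined[OF t])
  then have c: "x \<in> carrier E" "y \<in> carrier F" if "t x = Some y" for x y
    using that by (auto simp: linear_operator_def)
  note iff = adjoint_op_eq_Some_iff[OF E.hilbert_module_axioms dense]
  show ?thesis
  proof unfold_locales
    show "linear_operator F E (adjoint_op E F t)"
      unfolding linear_operator_def iff
      by (auto simp: c E.ip_simps F.ip_simps)
    show "\<langle>y, v\<rangle>\<^bsub>F\<^esub> = \<langle>x, w\<rangle>\<^bsub>E\<^esub>" if "t x = Some y" "adjoint_op E F t v = Some w" for x y v w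
      using that by (simp add: iff)
  qed (rule lin)
qed

lemma closed_operator_adjoint_op:
  assumes t: "densely_defined_operator E F t"
  shows "closed_operator F E (adjoint_op E F t)"
  unfolding closed_operator_def
proof (intro allI impI, elim conjE)
  interpret E: hilbert_module E using assms by (simp add: densely_defined_operator_def)
  interpret F: hilbert_module F using assms by (simp add: densely_defined_operator_def)
  have dense: "hdense E (dom t)" using t by (simp add: densely_defined_operator_def)
  note iff = adjoint_op_eq_Some_iff[OF E.hilbert_module_axioms dense]
  have c: "x \<in> carrier E" "y \<in> carrier F" if "t x = Some y" for x y
    using that linear_operator_if_densely_defined[OF t] by (auto simp: linear_operator_def)
  fix u y z
  assume u: "\<forall>n. u n \<in> dom (adjoint_op E F t)" and y: "y \<in> carrier F" and z: "z \<in> carrier E"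
    and lim: "hlimit F u y" "hlimit E (\<lambda>n. the (adjoint_op E F t (u n))) z"
  have tu: "adjoint_op E F t (u n) = Some (the (adjoint_op E F t (u n)))" for n
    using u by (metis domD option.sel)
  note tu' = tu[unfolded iff]
  have "\<langle>w, y\<rangle>\<^bsub>F\<^esub> = \<langle>x, z\<rangle>\<^bsub>E\<^esub>" if "t x = Some w" for x w
  proof (rule LIMSEQ_unique)
    show "(\<lambda>n. \<langle>w, u n\<rangle>\<^bsub>F\<^esub>) \<longlonglongrightarrow> \<langle>w, y\<rangle>\<^bsub>F\<^esub>"
      by (rule F.hlimit_ip[OF lim(1)]) (use tu' y c[OF that] in auto)
    have "(\<lambda>n. \<langle>x, the (adjoint_op E F t (u n))\<rangle>\<^bsub>E\<^esub>) \<longlonglongrightarrow> \<langle>x, z\<rangle>\<^bsub>E\<^esub>"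
      by (rule E.hlimit_ip[OF lim(2)]) (use tu' z c[OF that] in auto)
    moreover have "\<langle>x, the (adjoint_op E F t (u n))\<rangle>\<^bsub>E\<^esub> = \<langle>w, u n\<rangle>\<^bsub>F\<^esub>" for n
      using tu' that by auto
    ultimately show "(\<lambda>n. \<langle>w, u n\<rangle>\<^bsub>F\<^esub>) \<longlonglongrightarrow> \<langle>x, z\<rangle>\<^bsub>E\<^esub>" by simp
  qed
  then show "adjoint_op E F t y = Some z" using y z by (simp add: iff)
qed

lemma ran_one_plus:
  "ran (one_plus E (s \<circ>\<^sub>m t)) = {p \<oplus>\<^bsub>E\<^esub> r | p q r. t p = Some q \<and> s q = Some r}"
  by (auto simp: ran_def one_plus_def map_comp_Some_iff)

locale regular_operator =
  fixes E :: "('a::cstar_algebra, 'e) hmodule" and F :: "('a, 'f) hmodule" and t :: "'e \<rightharpoonup> 'f"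
  assumes regular: "regular E F t"
begin

lemma dense_domain: "densely_defined_operator E F t" "hdense E (dom t)"
  and dense_adjoint_domain: "hdense F (dom (adjoint_op E F t))"
  using regular by (auto simp: regular_def semi_regular_def densely_defined_operator_def)

sublocale formal_adjoints E F t "adjoint_op E F t"
  by (rule formal_adjoints_adjoint_op[OF dense_domain(1)])

lemma surjective_one_plus: "surjective_one_plus E t (adjoint_op E F t)"
proof (rule surjective_if_dense_range)
  show "closed_operator E F t" using regular by (simp add: regular_def)
  show "closed_operator F E (adjoint_op E F t)" by (rule closed_operator_adjoint_op[OF dense_domain(1)])
  fix x and e :: real assume "x \<in> carrier E" "0 < e"
  then obtain y where "y \<in> ran (one_plus E (adjoint_op E F t \<circ>\<^sub>m t))" "hdist E x y < e"
    using regular unfolding regular_def hdense_def by blast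
  then show "\<exists>p q r. t p = Some q \<and> adjoint_op E F t q = Some r \<and> hdist E x (p \<oplus>\<^bsub>E\<^esub> r) < e"
    unfolding ran_one_plus by blast
qed

lemma surjective_one_plus_adjoint: "surjective_one_plus F (adjoint_op E F t) t"
  using regular
  by (intro surjective_swap surjective_one_plus dense_adjoint_domain closed_operator_adjoint_op dense_domain)
     (simp add: regular_def)

text \<open>
  The domain of \<open>t\<^sup>\<star>t\<close> is dense in that of \<open>t\<close> by \<open>dense_core\<close>, hence dense in the module.
\<close>

lemma dense_domain_square:
  assumes x: "x \<in> carrier E" and e: "0 < e"
  shows "\<exists>p q r. t p = Some q \<and> adjoint_op E F t q = Some r \<and> hdist E x p < e"
proof -
  obtain x' where x': "x' \<in> dom t" "hdist E x x' < e / 2"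
    using dense_domain(2) x e unfolding hdense_def by (meson half_gt_zero)
  then obtain y where y: "t x' = Some y" by blast
  obtain p q r where pqr: "t p = Some q" "adjoint_op E F t q = Some r" "hdist E x' p < e / 2"
    using dense_core[OF surjective_one_plus y, of "e / 2"] e by auto
  have "hdist E x p < e"
    using E.hdist_triangle[OF x t_carrier(1)[OF y] t_carrier(1)[OF pqr(1)]] x'(2) pqr(3) by simp
  with pqr show ?thesis by blast
qed

end

lemma (in formal_adjoints) densely_defined:
  assumes "hdense E (dom t)"
  shows "densely_defined_operator E F t"
  unfolding densely_defined_operator_def
  using E.hilbert_module_axioms F.hilbert_module_axioms assms t[unfolded linear_operator_def]
  by (fastforce simp: ran_def)

text \<open>
  By \<open>s_contains_adjoint\<close> and its dual, each operator is the adjoint of the other, and adjoints are closed.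
\<close>

lemma (in formal_adjoints) regular_if_surjective:
  assumes surj: "surjective_one_plus E t s" "surjective_one_plus F s t"
    and dense: "hdense E (dom t)" "hdense F (dom s)"
  shows "regular E F t" and "adjoint_op E F t = s"
proof -
  interpret sw: formal_adjoints F E s t by (rule swap)
  show adj: "adjoint_op E F t = s"
  proof
    fix y
    have "adjoint_op E F t y = Some z \<longleftrightarrow> s y = Some z" for z
      unfolding adjoint_op_eq_Some_iff[OF E.hilbert_module_axioms dense(1)]
      using s_contains_adjoint[OF surj] adjoint s_carrier by blast
    then show "adjoint_op E F t y = s y" by (metis option.exhaust)
  qed
  have "adjoint_op F E s = t"
  proof
    fix x
    have "adjoint_op F E s x = Some y \<longleftrightarrow> t x = Some y" for y
      unfolding adjoint_op_eq_Some_iff[OF F.hilbert_module_axioms dense(2)]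
      using sw.s_contains_adjoint[OF surj(2,1)] sw.adjoint t_carrier by blast
    then show "adjoint_op F E s x = t x" by (metis option.exhaust)
  qed
  then have "closed_operator E F t"
    using closed_operator_adjoint_op[OF sw.densely_defined[OF dense(2)]] by simp
  moreover have "hdense E (ran (one_plus E (s \<circ>\<^sub>m t)))"
  proof -
    have "ran (one_plus E (s \<circ>\<^sub>m t)) = carrier E"
    proof (intro equalityI subsetI)
      fix x assume "x \<in> ran (one_plus E (s \<circ>\<^sub>m t))"
      then obtain p q r where "t p = Some q" "s q = Some r" "x = p \<oplus>\<^bsub>E\<^esub> r"
        unfolding ran_one_plus by blast
      then show "x \<in> carrier E" by (simp add: t_carrier s_carrier)
    next
      fix x assume "x \<in> carrier E"
      then show "x \<in> ran (one_plus E (s \<circ>\<^sub>m t))"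
        unfolding ran_one_plus using surj(1) unfolding surjective_one_plus_def by blast
    qed
    then show ?thesis unfolding hdense_def by (metis E.hdist_self order_refl)
  qed
  ultimately show "regular E F t"
    unfolding regular_def semi_regular_def adj
    using densely_defined[OF dense(1)] dense(2) by simp
qed

section \<open>Finite direct sums\<close>

text \<open>
  With finitely many nonzero summands the summability condition in the carrier of the direct sum is void
  and all inner products are finite sums over \<open>support\<close>.
\<close>

locale finite_family =
  fixes M :: "'i \<Rightarrow> ('a::cstar_algebra, 'e) hmodule"
  assumes hilbert: "\<And>k. hilbert_module (M k)"
    and finite_support: "finite {k. carrier (M k) \<noteq> {\<zero>\<^bsub>M k\<^esub>}}"
begin

definition support :: "'i set" where
  "support = {k. carrier (M k) \<noteq> {\<zero>\<^bsub>M k\<^esub>}}"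

lemma finite_support_set [simp]: "finite support"
  by (simp add: support_def finite_support)

lemma eq_zero: "k \<notin> support \<Longrightarrow> x \<in> carrier (M k) \<Longrightarrow> x = \<zero>\<^bsub>M k\<^esub>"
  by (auto simp: support_def)

lemma ip_eq_zero:
  "k \<notin> support \<Longrightarrow> x \<in> carrier (M k) \<Longrightarrow> y \<in> carrier (M k) \<Longrightarrow> \<langle>x, y\<rangle>\<^bsub>M k\<^esub> = 0"
  using eq_zero[of k x] hilbert_module.ip_zero_left[OF hilbert] by simp

abbreviation "S \<equiv> direct_sum M"

lemma carrier_direct_sum: "x \<in> carrier S \<longleftrightarrow> (\<forall>k. x k \<in> carrier (M k))"
proof -
  have "(\<lambda>k. \<langle>x k, x k\<rangle>\<^bsub>M k\<^esub>) summable_on UNIV" if "\<forall>k. x k \<in> carrier (M k)"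
    by (rule finite_nonzero_values_imp_summable_on, rule finite_subset[OF _ finite_support_set])
       (use that ip_eq_zero in auto)
  then show ?thesis by (auto simp: direct_sum_def)
qed

lemma direct_sum_simps [simp]:
  "x \<oplus>\<^bsub>S\<^esub> y = (\<lambda>k. x k \<oplus>\<^bsub>M k\<^esub> y k)"
  "\<zero>\<^bsub>S\<^esub> = (\<lambda>k. \<zero>\<^bsub>M k\<^esub>)"
  "c \<odot>\<^bsub>S\<^esub> x = (\<lambda>k. c \<odot>\<^bsub>M k\<^esub> x k)"
  "x \<triangleleft>\<^bsub>S\<^esub> a = (\<lambda>k. x k \<triangleleft>\<^bsub>M k\<^esub> a)"
  by (simp_all add: direct_sum_def)

lemma ip_direct_sum_infsum: "\<langle>x, y\<rangle>\<^bsub>S\<^esub> = (\<Sum>\<^sub>\<infinity>k. \<langle>x k, y k\<rangle>\<^bsub>M k\<^esub>)"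
  by (simp add: direct_sum_def)

lemma ip_direct_sum:
  assumes "x \<in> carrier S" "y \<in> carrier S"
  shows "\<langle>x, y\<rangle>\<^bsub>S\<^esub> = (\<Sum>k\<in>support. \<langle>x k, y k\<rangle>\<^bsub>M k\<^esub>)"
proof -
  have "(\<Sum>\<^sub>\<infinity>k. \<langle>x k, y k\<rangle>\<^bsub>M k\<^esub>) = (\<Sum>\<^sub>\<infinity>k\<in>support. \<langle>x k, y k\<rangle>\<^bsub>M k\<^esub>)"
    by (rule infsum_cong_neutral) (use assms ip_eq_zero in \<open>auto simp: carrier_direct_sum\<close>)
  then show ?thesis by (simp add: ip_direct_sum_infsum)
qed

lemma abelian_group_direct_sum: "abelian_group S"
proof (rule abelian_groupI)
  have ag: "abelian_group (M k)" for k
    using hilbert[of k] by (simp add: hilbert_module_def module_def)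
  then have am: "abelian_monoid (M k)" for k by (simp add: abelian_group_def)
  show "x \<oplus>\<^bsub>S\<^esub> y \<in> carrier S" if "x \<in> carrier S" "y \<in> carrier S" for x y
    using that by (simp add: carrier_direct_sum abelian_monoid.a_closed[OF am])
  show "x \<oplus>\<^bsub>S\<^esub> y \<oplus>\<^bsub>S\<^esub> z = x \<oplus>\<^bsub>S\<^esub> (y \<oplus>\<^bsub>S\<^esub> z)"
    if "x \<in> carrier S" "y \<in> carrier S" "z \<in> carrier S" for x y z
    using that by (simp add: carrier_direct_sum abelian_monoid.a_assoc[OF am])
  show "x \<oplus>\<^bsub>S\<^esub> y = y \<oplus>\<^bsub>S\<^esub> x" if "x \<in> carrier S" "y \<in> carrier S" for x y
    using that by (simp add: carrier_direct_sum abelian_monoid.a_comm[OF am])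
  show "\<zero>\<^bsub>S\<^esub> \<oplus>\<^bsub>S\<^esub> x = x" if "x \<in> carrier S" for x
    using that by (simp add: carrier_direct_sum abelian_monoid.l_zero[OF am])
  show "\<zero>\<^bsub>S\<^esub> \<in> carrier S"
    by (simp add: carrier_direct_sum abelian_monoid.zero_closed[OF am])
  show "\<exists>y\<in>carrier S. y \<oplus>\<^bsub>S\<^esub> x = \<zero>\<^bsub>S\<^esub>" if "x \<in> carrier S" for x
    using that by (intro bexI[of _ "\<lambda>k. \<ominus>\<^bsub>M k\<^esub> x k"])
      (simp_all add: carrier_direct_sum abelian_group.l_neg[OF ag] abelian_group.a_inv_closed[OF ag])
qed

lemma minus_direct_sum:
  assumes "x \<in> carrier S" "y \<in> carrier S"
  shows "x \<ominus>\<^bsub>S\<^esub> y = (\<lambda>k. x k \<ominus>\<^bsub>M k\<^esub> y k)"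
proof -
  interpret S: abelian_group S by (rule abelian_group_direct_sum)
  have ag: "abelian_group (M k)" for k
    using hilbert[of k] by (simp add: hilbert_module_def module_def)
  have "\<ominus>\<^bsub>S\<^esub> y = (\<lambda>k. \<ominus>\<^bsub>M k\<^esub> y k)"
    using assms(2)
    by (intro S.minus_equality) (simp_all add: carrier_direct_sum abelian_group.l_neg[OF ag]
        abelian_group.a_inv_closed[OF ag])
  then show ?thesis by (simp add: a_minus_def)
qed

text \<open>
  The remaining summands of \<open>\<langle>x, x\<rangle>\<close> form a positive element, and the norm is monotone on positive elements.
\<close>

lemma norm_component_le:
  assumes x: "x \<in> carrier S"
  shows "norm (\<langle>x k, x k\<rangle>\<^bsub>M k\<^esub>) \<le> norm (\<langle>x, x\<rangle>\<^bsub>S\<^esub>)"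
proof (cases "k \<in> support")
  case True
  have pos: "positive (\<langle>x j, x j\<rangle>\<^bsub>M j\<^esub>)" for j
    using x hilbert_module.ip_positive[OF hilbert] by (simp add: carrier_direct_sum)
  have "\<langle>x, x\<rangle>\<^bsub>S\<^esub> = \<langle>x k, x k\<rangle>\<^bsub>M k\<^esub> + (\<Sum>j\<in>support - {k}. \<langle>x j, x j\<rangle>\<^bsub>M j\<^esub>)"
    using True by (simp add: ip_direct_sum x sum.remove)
  then show ?thesis by (simp add: norm_le_norm_add positive_sum pos)
qed (use x ip_eq_zero in \<open>auto simp: carrier_direct_sum\<close>)

lemma hdist_component_le:
  assumes "x \<in> carrier S" "y \<in> carrier S"
  shows "hdist (M k) (x k) (y k) \<le> hdist S x y"
  using norm_component_le[of "x \<ominus>\<^bsub>S\<^esub> y" k] assms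
    abelian_group.minus_closed[OF abelian_group_direct_sum assms]
  by (simp add: hdist_def hnorm_def minus_direct_sum)

lemma hdist_direct_sum_le:
  assumes "x \<in> carrier S" "y \<in> carrier S"
  shows "hdist S x y \<le> sqrt (\<Sum>k\<in>support. (hdist (M k) (x k) (y k))\<^sup>2)"
proof -
  have "x \<ominus>\<^bsub>S\<^esub> y \<in> carrier S"
    by (rule abelian_group.minus_closed[OF abelian_group_direct_sum assms])
  then have "norm (\<langle>x \<ominus>\<^bsub>S\<^esub> y, x \<ominus>\<^bsub>S\<^esub> y\<rangle>\<^bsub>S\<^esub>) \<le> (\<Sum>k\<in>support. (hdist (M k) (x k) (y k))\<^sup>2)"
    using assms by (simp add: ip_direct_sum minus_direct_sum hdist_def hnorm_def norm_sum)
  then show ?thesis by (simp add: hdist_def hnorm_def)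
qed

lemma complete_direct_sum:
  assumes u: "\<And>n. u n \<in> carrier S" and cauchy: "hcauchy S u"
  shows "\<exists>x\<in>carrier S. hlimit S u x"
proof -
  have "\<exists>x\<in>carrier (M k). hlimit (M k) (\<lambda>n. u n k) x" for k
  proof (rule hilbert_module.complete[OF hilbert])
    show "u n k \<in> carrier (M k)" for n using u by (simp add: carrier_direct_sum)
    show "hcauchy (M k) (\<lambda>n. u n k)"
      using cauchy hdist_component_le[OF u u] unfolding hcauchy_def by (meson le_less_trans)
  qed
  then obtain x where x: "\<And>k. x k \<in> carrier (M k)" "\<And>k. hlimit (M k) (\<lambda>n. u n k) (x k)" by metis
  have xS: "x \<in> carrier S" using x by (simp add: carrier_direct_sum)
  have "(\<lambda>n. \<Sum>k\<in>support. (hdist (M k) (u n k) (x k))\<^sup>2) \<longlonglongrightarrow> (\<Sum>k\<in>support. 0\<^sup>2)"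
    using x(2) unfolding hlimit_def by (intro tendsto_sum tendsto_power)
  then have lim: "(\<lambda>n. sqrt (\<Sum>k\<in>support. (hdist (M k) (u n k) (x k))\<^sup>2)) \<longlonglongrightarrow> 0"
    using tendsto_real_sqrt by fastforce
  have "hlimit S u x"
    unfolding hlimit_def
    by (rule Lim_null_comparison[OF _ lim])
       (use hdist_direct_sum_le[OF u xS] in \<open>simp add: hdist_def hnorm_def\<close>)
  with xS show ?thesis by blast
qed

lemma hilbert_module_direct_sum: "hilbert_module S"
proof -
  note hm = hilbert_module.axioms[OF hilbert] hilbert
  note smult = hilbert_module.smult_carrier[OF hilbert]
  note ract = hilbert_module.ract_closed[OF hilbert]
  note c = carrier_direct_sum
  have add: "abelian_monoid (M k)" for k
    using hilbert[of k] by (simp add: hilbert_module_def module_def abelian_group_def)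
  note add = abelian_monoid.a_closed[OF add]
  have "Module.module (ring_of_type_algebra :: complex ring) S"
  proof (rule moduleI)
    show "cring (ring_of_type_algebra :: complex ring)" using hm(1) by (simp add: module_def)
  qed (auto simp: abelian_group_direct_sum c smult hilbert_module.smult_add_left[OF hilbert]
       hilbert_module.smult_add_right[OF hilbert] hilbert_module.smult_smult[OF hilbert]
       hilbert_module.smult_1[OF hilbert] ring_of_type_algebra_def)
  moreover have "hilbert_module_axioms S"
  proof
    fix x a b k assume x: "x \<in> carrier S"
    note xs = x[unfolded c, rule_format]
    show "x \<triangleleft>\<^bsub>S\<^esub> a \<in> carrier S" using xs by (simp add: c ract)
    show "x \<triangleleft>\<^bsub>S\<^esub> (a + b) = x \<triangleleft>\<^bsub>S\<^esub> a \<oplus>\<^bsub>S\<^esub> x \<triangleleft>\<^bsub>S\<^esub> b"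
      using xs by (simp add: hilbert_module.ract_add_right[OF hilbert])
    show "x \<triangleleft>\<^bsub>S\<^esub> (a * b) = x \<triangleleft>\<^bsub>S\<^esub> a \<triangleleft>\<^bsub>S\<^esub> b"
      using xs by (simp add: hilbert_module.ract_mult[OF hilbert])
    show "(k \<odot>\<^bsub>S\<^esub> x) \<triangleleft>\<^bsub>S\<^esub> a = k \<odot>\<^bsub>S\<^esub> (x \<triangleleft>\<^bsub>S\<^esub> a)"
      using xs by (simp add: hilbert_module.ract_smult[OF hilbert])
    show "x \<triangleleft>\<^bsub>S\<^esub> scaleC k a = k \<odot>\<^bsub>S\<^esub> (x \<triangleleft>\<^bsub>S\<^esub> a)"
      using xs by (simp add: hilbert_module.ract_scaleC[OF hilbert])
    show "positive (\<langle>x, x\<rangle>\<^bsub>S\<^esub>)"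
      using xs by (simp add: ip_direct_sum x positive_sum hilbert_module.ip_positive[OF hilbert])
    show "x = \<zero>\<^bsub>S\<^esub>" if "\<langle>x, x\<rangle>\<^bsub>S\<^esub> = 0"
      using norm_component_le[OF x] xs that hilbert_module.ip_definite[OF hilbert] by fastforce
    fix y assume y: "y \<in> carrier S"
    note ys = y[unfolded c, rule_format]
    show "(x \<oplus>\<^bsub>S\<^esub> y) \<triangleleft>\<^bsub>S\<^esub> a = x \<triangleleft>\<^bsub>S\<^esub> a \<oplus>\<^bsub>S\<^esub> y \<triangleleft>\<^bsub>S\<^esub> a"
      using xs ys by (simp add: hilbert_module.ract_add_left[OF hilbert])
    have sy: "k \<odot>\<^bsub>S\<^esub> y \<in> carrier S" "y \<triangleleft>\<^bsub>S\<^esub> a \<in> carrier S"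
      using ys by (simp_all add: c smult ract)
    show "\<langle>x, k \<odot>\<^bsub>S\<^esub> y\<rangle>\<^bsub>S\<^esub> = scaleC k (\<langle>x, y\<rangle>\<^bsub>S\<^esub>)"
      using xs ys unfolding ip_direct_sum[OF x sy(1)]
      by (simp add: ip_direct_sum x y hilbert_module.ip_smult_right[OF hilbert] scaleC_sum)
    show "\<langle>x, y \<triangleleft>\<^bsub>S\<^esub> a\<rangle>\<^bsub>S\<^esub> = \<langle>x, y\<rangle>\<^bsub>S\<^esub> * a"
      using xs ys unfolding ip_direct_sum[OF x sy(2)]
      by (simp add: ip_direct_sum x y hilbert_module.ip_ract_right[OF hilbert] sum_distrib_right)
    show "star (\<langle>x, y\<rangle>\<^bsub>S\<^esub>) = \<langle>y, x\<rangle>\<^bsub>S\<^esub>"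
      using xs ys by (simp add: ip_direct_sum x y hilbert_module.ip_star[OF hilbert] star_sum)
    fix z assume z: "z \<in> carrier S"
    note zs = z[unfolded c, rule_format]
    have yz: "y \<oplus>\<^bsub>S\<^esub> z \<in> carrier S" using ys zs by (simp add: c add)
    show "\<langle>x, y \<oplus>\<^bsub>S\<^esub> z\<rangle>\<^bsub>S\<^esub> = \<langle>x, y\<rangle>\<^bsub>S\<^esub> + \<langle>x, z\<rangle>\<^bsub>S\<^esub>"
      using xs ys zs unfolding ip_direct_sum[OF x yz]
      by (simp add: ip_direct_sum x y z hilbert_module.ip_add_right[OF hilbert] sum.distrib)
  qed (rule complete_direct_sum)
  ultimately show ?thesis by (rule hilbert_module.intro)
qed

lemma hdense_direct_sum:
  assumes dense: "\<And>k. hdense (M k) (D k)"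
  shows "hdense S {x. \<forall>k. x k \<in> D k}"
  unfolding hdense_def
proof (intro conjI ballI allI impI)
  show "{x. \<forall>k. x k \<in> D k} \<subseteq> carrier S"
    using dense unfolding hdense_def carrier_direct_sum subset_iff by blast
  fix x and e :: real assume x: "x \<in> carrier S" and e: "0 < e"
  \<comment> \<open>chosen so that \<open>card support\<close> errors of size d have squares adding up to less than \<open>e\<^sup>2\<close>\<close>
  define d where "d = e / (1 + real (card support))"
  have d: "0 < d" using e by (simp add: d_def add_pos_nonneg)
  then have "\<exists>y. y \<in> D k \<and> hdist (M k) (x k) y < d" for k
    using dense[of k] x unfolding hdense_def carrier_direct_sum by blast
  then obtain y where y: "\<And>k. y k \<in> D k" "\<And>k. hdist (M k) (x k) (y k) < d" by metis
  have yS: "y \<in> carrier S"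
    using y(1) dense unfolding hdense_def carrier_direct_sum subset_iff by blast
  have "(\<Sum>k\<in>support. (hdist (M k) (x k) (y k))\<^sup>2) \<le> (\<Sum>k\<in>support. d\<^sup>2)"
    using y(2) by (intro sum_mono power_mono) (auto simp: less_imp_le hdist_def hnorm_def)
  also have "\<dots> < (1 + real (card support)) * (1 + real (card support)) * d\<^sup>2"
    using d by (simp add: algebra_simps add_pos_nonneg)
  also have "\<dots> = ((1 + real (card support)) * d)\<^sup>2" by (simp add: power2_eq_square mult_ac)
  also have "(1 + real (card support)) * d = e"
  proof -
    have "1 + real (card support) \<noteq> 0" by linarith
    then show ?thesis by (simp add: d_def)
  qed
  finally have "sqrt (\<Sum>k\<in>support. (hdist (M k) (x k) (y k))\<^sup>2) < e"
    using e by (metis abs_of_pos real_sqrt_abs real_sqrt_less_iff)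
  then have "hdist S x y < e" using hdist_direct_sum_le[OF x yS] by linarith
  then show "\<exists>y\<in>{x. \<forall>k. x k \<in> D k}. hdist S x y < e" using y(1) by blast
qed

end

section \<open>Two consecutive operators of a complex\<close>

locale composable_pair =
  fixes E0 E1 E2 :: "('a::cstar_algebra, 'e) hmodule" and s t :: "'e \<rightharpoonup> 'e"
  assumes s: "regular E0 E1 s" and t: "regular E1 E2 t"
    and comp_zero: "\<And>x y. s x = Some y \<Longrightarrow> t y = Some \<zero>\<^bsub>E2\<^esub>"
begin

abbreviation "s' \<equiv> adjoint_op E0 E1 s"
abbreviation "t' \<equiv> adjoint_op E1 E2 t"

lemma formal_s: "formal_adjoints E0 E1 s s'" and formal_t: "formal_adjoints E1 E2 t t'"
  using s t regular_operator.dense_domain(1) formal_adjoints_adjoint_op regular_operator.intro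
  by blast+

text \<open>
  \<open>\<langle>sx, t\<^sup>\<star>z\<rangle> = \<langle>tsx, z\<rangle> = 0\<close>, so \<open>t\<^sup>\<star>z\<close> lies in the domain of \<open>s\<^sup>\<star>\<close> and is annihilated by it.
\<close>

lemma adjoint_comp_zero:
  assumes "t' z = Some w"
  shows "s' w = Some \<zero>\<^bsub>E0\<^esub>"
proof -
  interpret s: regular_operator E0 E1 s by unfold_locales (rule s)
  note ft = formal_t
  have w: "w \<in> carrier E1" and z: "z \<in> carrier E2"
    using formal_adjoints.s_carrier[OF ft assms] by auto
  have "\<langle>y, w\<rangle>\<^bsub>E1\<^esub> = \<langle>x, \<zero>\<^bsub>E0\<^esub>\<rangle>\<^bsub>E0\<^esub>" if "s x = Some y" for x y
  proof -
    have "\<langle>y, w\<rangle>\<^bsub>E1\<^esub> = \<langle>\<zero>\<^bsub>E2\<^esub>, z\<rangle>\<^bsub>E2\<^esub>"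
      using formal_adjoints.adjoint[OF ft comp_zero[OF that] assms] by simp
    then show ?thesis
      using z hilbert_module.ip_zero_left[of E2 z] ft s.t_carrier[OF that]
      by (simp add: formal_adjoints_def)
  qed
  then show ?thesis
    using w by (simp add: adjoint_op_eq_Some_iff[OF s.E.hilbert_module_axioms s.dense_domain(2)])
qed

text \<open>
  Solve \<open>p + t\<^sup>\<star>tp = y\<close> and \<open>p' + s s\<^sup>\<star>p' = y\<close>. The vector \<open>r = p + p' - y\<close> equals both \<open>p - s s\<^sup>\<star>p'\<close> and
  \<open>p' - t\<^sup>\<star>tp\<close>. From \<open>ts = 0\<close> and \<open>s\<^sup>\<star>t\<^sup>\<star> = 0\<close> it follows that \<open>tr = tp\<close> and \<open>s\<^sup>\<star>r = s\<^sup>\<star>p'\<close>, so that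
  \<open>t\<^sup>\<star>tr + s s\<^sup>\<star>r = (y - p) + (y - p') = y - r\<close>.
\<close>

lemma solve_one_plus_laplacian:
  assumes y: "y \<in> carrier E1"
  shows "\<exists>r b c d e. t r = Some b \<and> t' b = Some c \<and> s' r = Some d \<and> s d = Some e \<and>
    y = r \<oplus>\<^bsub>E1\<^esub> (c \<oplus>\<^bsub>E1\<^esub> e)"
proof -
  interpret s: formal_adjoints E0 E1 s s' by (rule formal_s)
  interpret t: formal_adjoints E1 E2 t t' by (rule formal_t)
  have rt: "regular_operator E1 E2 t" "regular_operator E0 E1 s"
    by (simp_all add: regular_operator_def s t)
  obtain p b c where p: "t p = Some b" "t' b = Some c" "y = p \<oplus>\<^bsub>E1\<^esub> c"
    using regular_operator.surjective_one_plus[OF rt(1)] y unfolding surjective_one_plus_def by blast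
  obtain p' d e where p': "s' p' = Some d" "s d = Some e" "y = p' \<oplus>\<^bsub>E1\<^esub> e"
    using regular_operator.surjective_one_plus_adjoint[OF rt(2)] y unfolding surjective_one_plus_def by blast
  note car = t.t_carrier[OF p(1)] t.s_carrier[OF p(2)] s.s_carrier[OF p'(1)] s.t_carrier[OF p'(2)]
  have eq: "\<langle>z, p\<rangle>\<^bsub>E1\<^esub> + \<langle>z, c\<rangle>\<^bsub>E1\<^esub> = \<langle>z, p'\<rangle>\<^bsub>E1\<^esub> + \<langle>z, e\<rangle>\<^bsub>E1\<^esub>" if "z \<in> carrier E1" for z
    using p(3) p'(3) car that by (metis s.F.ip_add_right)
  have "p \<ominus>\<^bsub>E1\<^esub> e = p' \<ominus>\<^bsub>E1\<^esub> c"
    by (rule s.F.vector_eqI) (use eq car in \<open>simp_all add: s.F.ip_simps algebra_simps\<close>)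
  moreover have "t (p \<ominus>\<^bsub>E1\<^esub> e) = Some (b \<ominus>\<^bsub>E2\<^esub> \<zero>\<^bsub>E2\<^esub>)"
    by (rule t.t_diff[OF p(1) comp_zero[OF p'(2)]])
  moreover have "b \<ominus>\<^bsub>E2\<^esub> \<zero>\<^bsub>E2\<^esub> = b" by (rule t.F.vector_eqI) (simp_all add: car t.F.ip_simps)
  moreover have "s' (p' \<ominus>\<^bsub>E1\<^esub> c) = Some (d \<ominus>\<^bsub>E0\<^esub> \<zero>\<^bsub>E0\<^esub>)"
    by (rule s.s_diff[OF p'(1) adjoint_comp_zero[OF p(2)]])
  moreover have "d \<ominus>\<^bsub>E0\<^esub> \<zero>\<^bsub>E0\<^esub> = d" by (rule s.E.vector_eqI) (simp_all add: car s.E.ip_simps)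
  moreover have "y = (p \<ominus>\<^bsub>E1\<^esub> e) \<oplus>\<^bsub>E1\<^esub> (c \<oplus>\<^bsub>E1\<^esub> e)"
    unfolding p(3) by (rule s.F.vector_eqI) (simp_all add: car s.F.ip_simps)
  ultimately show ?thesis using p(2) p'(2) by metis
qed

text \<open>
  Choose \<open>p\<close> in the domain of \<open>t\<^sup>\<star>t\<close> close to \<open>x\<close>, then \<open>v\<close> in the domain of \<open>s\<^sup>\<star>\<close> close to \<open>p + t\<^sup>\<star>tp\<close>, and
  solve \<open>p' + t\<^sup>\<star>tp' = v\<close>. As the inverse of \<open>1 + t\<^sup>\<star>t\<close> is contractive, \<open>p'\<close> is close to \<open>p\<close>; and
  \<open>p' = v - t\<^sup>\<star>tp'\<close> is in the domain of \<open>s\<^sup>\<star>\<close> because \<open>s\<^sup>\<star>t\<^sup>\<star> = 0\<close>.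
\<close>

lemma dense_common_domain: "hdense E1 (dom t \<inter> dom s')"
  unfolding hdense_def
proof (intro conjI ballI allI impI)
  interpret s: formal_adjoints E0 E1 s s' by (rule formal_s)
  interpret t: formal_adjoints E1 E2 t t' by (rule formal_t)
  have rt: "regular_operator E1 E2 t" "regular_operator E0 E1 s"
    by (simp_all add: regular_operator_def s t)
  show "dom t \<inter> dom s' \<subseteq> carrier E1" using t.t_carrier by blast
  fix x and \<epsilon> :: real assume x: "x \<in> carrier E1" and "0 < \<epsilon>"
  then have e2: "0 < \<epsilon> / 2" by simp
  obtain p q c where p: "t p = Some q" "t' q = Some c" "hdist E1 x p < \<epsilon> / 2"
    using regular_operator.dense_domain_square[OF rt(1) x e2] by blast
  note cp = t.t_carrier[OF p(1)] t.s_carrier[OF p(2)]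
  obtain v w where v: "s' v = Some w" "hdist E1 (p \<oplus>\<^bsub>E1\<^esub> c) v < \<epsilon> / 2"
    using regular_operator.dense_adjoint_domain[OF rt(2)] cp e2 unfolding hdense_def
    by (metis domD s.F.M.add.m_closed)
  obtain p' q' c' where p': "t p' = Some q'" "t' q' = Some c'" "v = p' \<oplus>\<^bsub>E1\<^esub> c'"
    using regular_operator.surjective_one_plus[OF rt(1)] s.s_carrier[OF v(1)]
    unfolding surjective_one_plus_def by blast
  note cp' = t.t_carrier[OF p'(1)] t.s_carrier[OF p'(2)] s.s_carrier[OF v(1)]
  have "v \<ominus>\<^bsub>E1\<^esub> c' = p'"
    by (rule s.F.vector_eqI) (simp_all add: p'(3) cp' s.F.ip_simps)
  then have "s' p' = Some (w \<ominus>\<^bsub>E0\<^esub> \<zero>\<^bsub>E0\<^esub>)"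
    using s.s_diff[OF v(1) adjoint_comp_zero[OF p'(2)]] by simp
  moreover have "hdist E1 x p' < \<epsilon>"
  proof -
    have "(p \<ominus>\<^bsub>E1\<^esub> p') \<oplus>\<^bsub>E1\<^esub> (c \<ominus>\<^bsub>E1\<^esub> c') = (p \<oplus>\<^bsub>E1\<^esub> c) \<ominus>\<^bsub>E1\<^esub> v"
      by (rule s.F.vector_eqI) (simp_all add: p'(3) cp cp' s.F.ip_simps)
    then have "hdist E1 p p' \<le> hdist E1 (p \<oplus>\<^bsub>E1\<^esub> c) v"
      using t.one_plus_bounds(1)[OF t.t_diff[OF p(1) p'(1)] t.s_diff[OF p(2) p'(2)]]
      by (simp add: hdist_def)
    then show ?thesis using s.F.hdist_triangle[OF x cp(1) cp'(1)] p(3) v(2) by linarith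
  qed
  ultimately show "\<exists>y\<in>dom t \<inter> dom s'. hdist E1 x y < \<epsilon>" using p'(1) by blast
qed

end

section \<open>Bidiagonal operators\<close>

text \<open>
  The matrix of this operator between the direct sums has the entries \<open>A k\<close> in position \<open>(k, k)\<close> and \<open>C k\<close> in
  position \<open>(k, \<sigma> k)\<close>.
\<close>

definition bidiagonal_op ::
  "('i \<Rightarrow> ('a::cstar_algebra, 'e) hmodule) \<Rightarrow> ('i \<Rightarrow> 'e \<rightharpoonup> 'e) \<Rightarrow> ('i \<Rightarrow> 'e \<rightharpoonup> 'e) \<Rightarrow> ('i \<Rightarrow> 'i) \<Rightarrow>
    (('i \<Rightarrow> 'e) \<rightharpoonup> ('i \<Rightarrow> 'e))" where
  "bidiagonal_op F A C \<sigma> = (\<lambda>x.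
     if \<forall>k. x k \<in> dom (A k) \<and> x (\<sigma> k) \<in> dom (C k)
     then Some (\<lambda>k. the (A k (x k)) \<oplus>\<^bsub>F k\<^esub> the (C k (x (\<sigma> k)))) else None)"

lemma bidiagonal_op_eq_Some_iff:
  "bidiagonal_op F A C \<sigma> x = Some y \<longleftrightarrow>
    (\<exists>p q. (\<forall>k. A k (x k) = Some (p k)) \<and> (\<forall>k. C k (x (\<sigma> k)) = Some (q k)) \<and>
      y = (\<lambda>k. p k \<oplus>\<^bsub>F k\<^esub> q k))" (is "?L \<longleftrightarrow> ?R")
proof
  assume ?L
  then have dom: "\<forall>k. x k \<in> dom (A k) \<and> x (\<sigma> k) \<in> dom (C k)"
    and y: "y = (\<lambda>k. the (A k (x k)) \<oplus>\<^bsub>F k\<^esub> the (C k (x (\<sigma> k))))"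
    by (auto simp: bidiagonal_op_def split: if_splits)
  have "A k (x k) = Some (the (A k (x k)))" "C k (x (\<sigma> k)) = Some (the (C k (x (\<sigma> k))))" for k
    using dom by (metis domD option.sel)+
  with y show ?R
    by (intro exI[of _ "\<lambda>k. the (A k (x k))"] exI[of _ "\<lambda>k. the (C k (x (\<sigma> k)))"]) blast
next
  assume ?R
  then show ?L by (auto simp: bidiagonal_op_def)
qed

text \<open>
  The modules \<open>M k\<close>, \<open>F k\<close>, \<open>M (\<sigma> k)\<close>, \<open>F (\<sigma> k)\<close>, linked by \<open>A k\<close>, \<open>B k\<close>, \<open>A (\<sigma> k)\<close>, are consecutive members of a
  complex, and the primed operators are formal adjoints. The assumptions are stated so that they are
  preserved when the families and the direction of the arrows are exchanged; this is why the
  index shift \<open>\<sigma>\<close> is an arbitrary bijection with inverse \<open>\<tau>\<close>.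
\<close>

locale bidiagonal =
  fixes M F :: "'i \<Rightarrow> ('a::cstar_algebra, 'e) hmodule"
    and A A' B B' :: "'i \<Rightarrow> 'e \<rightharpoonup> 'e" and \<sigma> \<tau> :: "'i \<Rightarrow> 'i"
  assumes \<sigma>\<tau> [simp]: "\<And>k. \<sigma> (\<tau> k) = k" and \<tau>\<sigma> [simp]: "\<And>k. \<tau> (\<sigma> k) = k"
    and M: "finite_family M" and F: "finite_family F"
    and A: "\<And>k. formal_adjoints (M k) (F k) (A k) (A' k)"
    and B: "\<And>k. formal_adjoints (F k) (M (\<sigma> k)) (B k) (B' k)"
    and BA: "\<And>k x y. A k x = Some y \<Longrightarrow> B k y = Some \<zero>\<^bsub>M (\<sigma> k)\<^esub>"
    and AB: "\<And>k x y. B k x = Some y \<Longrightarrow> A (\<sigma> k) y = Some \<zero>\<^bsub>F (\<sigma> k)\<^esub>"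
    and A'B': "\<And>k x y. B' k x = Some y \<Longrightarrow> A' k y = Some \<zero>\<^bsub>M k\<^esub>"
    and B'A': "\<And>k x y. A' (\<sigma> k) x = Some y \<Longrightarrow> B' k y = Some \<zero>\<^bsub>F k\<^esub>"
    and solve_M: "\<And>k y. y \<in> carrier (M (\<sigma> k)) \<Longrightarrow> \<exists>r b c d e. A (\<sigma> k) r = Some b \<and> A' (\<sigma> k) b = Some c \<and>
        B' k r = Some d \<and> B k d = Some e \<and> y = r \<oplus>\<^bsub>M (\<sigma> k)\<^esub> (c \<oplus>\<^bsub>M (\<sigma> k)\<^esub> e)"
    and solve_F: "\<And>k y. y \<in> carrier (F k) \<Longrightarrow> \<exists>r b c d e. B k r = Some b \<and> B' k b = Some c \<and>
        A' k r = Some d \<and> A k d = Some e \<and> y = r \<oplus>\<^bsub>F k\<^esub> (c \<oplus>\<^bsub>F k\<^esub> e)"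
    and dense_M: "\<And>k. hdense (M (\<sigma> k)) (dom (A (\<sigma> k)) \<inter> dom (B' k))"
    and dense_F: "\<And>k. hdense (F k) (dom (B k) \<inter> dom (A' k))"
begin

lemma dual: "bidiagonal F M A' A (\<lambda>k. B' (\<tau> k)) (\<lambda>k. B (\<tau> k)) \<tau> \<sigma>"
proof (rule bidiagonal.intro)
  fix k x y
  show "formal_adjoints (F k) (M k) (A' k) (A k)" by (rule formal_adjoints.swap[OF A])
  show "formal_adjoints (M k) (F (\<tau> k)) (B' (\<tau> k)) (B (\<tau> k))"
    using formal_adjoints.swap[OF B[of "\<tau> k"]] by simp
  show "A' k x = Some y \<Longrightarrow> B' (\<tau> k) y = Some \<zero>\<^bsub>F (\<tau> k)\<^esub>" using B'A'[of "\<tau> k"] by simp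
  show "B' (\<tau> k) x = Some y \<Longrightarrow> A' (\<tau> k) y = Some \<zero>\<^bsub>M (\<tau> k)\<^esub>" by (rule A'B')
  show "B (\<tau> k) x = Some y \<Longrightarrow> A k y = Some \<zero>\<^bsub>F k\<^esub>" using AB[of "\<tau> k"] by simp
  show "A (\<tau> k) x = Some y \<Longrightarrow> B (\<tau> k) y = Some \<zero>\<^bsub>M k\<^esub>" using BA[of "\<tau> k"] by simp
  show "hdense (F (\<tau> k)) (dom (A' (\<tau> k)) \<inter> dom (B (\<tau> k)))" using dense_F[of "\<tau> k"] by (simp add: Int_commute)
  show "hdense (M k) (dom (B' (\<tau> k)) \<inter> dom (A k))" using dense_M[of "\<tau> k"] by (simp add: Int_commute)
next
  fix k y assume y: "y \<in> carrier (F (\<tau> k))"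
  interpret Fk: hilbert_module "F (\<tau> k)" by (rule finite_family.hilbert[OF F])
  obtain r b c d e where r: "B (\<tau> k) r = Some b" "B' (\<tau> k) b = Some c" "A' (\<tau> k) r = Some d"
      "A (\<tau> k) d = Some e" "y = r \<oplus>\<^bsub>F (\<tau> k)\<^esub> (c \<oplus>\<^bsub>F (\<tau> k)\<^esub> e)"
    using solve_F[OF y] by blast
  moreover have "c \<oplus>\<^bsub>F (\<tau> k)\<^esub> e = e \<oplus>\<^bsub>F (\<tau> k)\<^esub> c"
    using formal_adjoints.s_carrier[OF B r(2)] formal_adjoints.t_carrier[OF A r(4)] by (simp add: Fk.M.a_comm)
  ultimately show "\<exists>r b c d e. A' (\<tau> k) r = Some b \<and> A (\<tau> k) b = Some c \<and> B (\<tau> k) r = Some d \<and>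
      B' (\<tau> k) d = Some e \<and> y = r \<oplus>\<^bsub>F (\<tau> k)\<^esub> (c \<oplus>\<^bsub>F (\<tau> k)\<^esub> e)" by metis
next
  fix k y assume y: "y \<in> carrier (M k)"
  interpret Mk: hilbert_module "M k" by (rule finite_family.hilbert[OF M])
  obtain r b c d e where r: "A k r = Some b" "A' k b = Some c" "B' (\<tau> k) r = Some d"
      "B (\<tau> k) d = Some e" "y = r \<oplus>\<^bsub>M k\<^esub> (c \<oplus>\<^bsub>M k\<^esub> e)"
    using solve_M[of y "\<tau> k"] y by auto
  moreover have "c \<oplus>\<^bsub>M k\<^esub> e = e \<oplus>\<^bsub>M k\<^esub> c"
    using formal_adjoints.s_carrier[OF A r(2)] formal_adjoints.t_carrier[OF B r(4)] by (simp add: Mk.M.a_comm)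
  ultimately show "\<exists>r b c d e. B' (\<tau> k) r = Some b \<and> B (\<tau> k) b = Some c \<and> A k r = Some d \<and>
      A' k d = Some e \<and> y = r \<oplus>\<^bsub>M k\<^esub> (c \<oplus>\<^bsub>M k\<^esub> e)" by metis
qed (simp_all add: M F)

abbreviation "D \<equiv> bidiagonal_op F A B' \<sigma>"
abbreviation "D' \<equiv> bidiagonal_op M A' (\<lambda>k. B (\<tau> k)) \<tau>"

lemma linear: "linear_operator (direct_sum M) (direct_sum F) D"
proof -
  interpret M: finite_family M by (rule M)
  interpret F: finite_family F by (rule F)
  note linA = formal_adjoints.t[OF A, unfolded linear_operator_def]
  note linB = formal_adjoints.s[OF B, unfolded linear_operator_def]
  \<comment> \<open>the clauses of linearity for A k and B' k, as conditional rewrite rules\<close>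
  note lin = linA[THEN conjunct1] linA[THEN conjunct2, THEN conjunct2, THEN conjunct1, rule_format]
    linA[THEN conjunct2, THEN conjunct2, THEN conjunct2, THEN conjunct1, rule_format]
    linA[THEN conjunct2, THEN conjunct2, THEN conjunct2, THEN conjunct2, rule_format]
    linB[THEN conjunct1] linB[THEN conjunct2, THEN conjunct2, THEN conjunct1, rule_format]
    linB[THEN conjunct2, THEN conjunct2, THEN conjunct2, THEN conjunct1, rule_format]
    linB[THEN conjunct2, THEN conjunct2, THEN conjunct2, THEN conjunct2, rule_format]
  note carA = formal_adjoints.t_carrier[OF A] and carB = formal_adjoints.s_carrier[OF B]
  note hF = F.hilbert
  have ab: "abelian_group (F k)" for k using hF[of k] by (simp add: hilbert_module_def module_def)
  then have am: "abelian_monoid (F k)" for k by (simp add: abelian_group_def)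
  show ?thesis
    unfolding linear_operator_def
  proof (intro conjI allI impI; (unfold bidiagonal_op_eq_Some_iff)?)
    show "\<exists>p q. (\<forall>k. A k (\<zero>\<^bsub>M.S\<^esub> k) = Some (p k)) \<and> (\<forall>k. B' k (\<zero>\<^bsub>M.S\<^esub> (\<sigma> k)) = Some (q k)) \<and>
        \<zero>\<^bsub>F.S\<^esub> = (\<lambda>k. p k \<oplus>\<^bsub>F k\<^esub> q k)"
      by (intro exI[of _ "\<lambda>k. \<zero>\<^bsub>F k\<^esub>"])
         (simp add: lin abelian_monoid.l_zero[OF am] abelian_monoid.zero_closed[OF am])
  next
    fix x y
    assume "\<exists>p q. (\<forall>k. A k (x k) = Some (p k)) \<and> (\<forall>k. B' k (x (\<sigma> k)) = Some (q k)) \<and>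
        y = (\<lambda>k. p k \<oplus>\<^bsub>F k\<^esub> q k)"
    then obtain p q where pq: "\<And>k. A k (x k) = Some (p k)" "\<And>k. B' k (x (\<sigma> k)) = Some (q k)"
        "y = (\<lambda>k. p k \<oplus>\<^bsub>F k\<^esub> q k)" by blast
    note car = carA[OF pq(1)] carB[OF pq(2)]
    show "x \<in> carrier M.S" "y \<in> carrier F.S"
      using car by (simp_all add: M.carrier_direct_sum F.carrier_direct_sum pq(3) abelian_monoid.a_closed[OF am])
    show "\<exists>p q. (\<forall>k. A k ((c \<odot>\<^bsub>M.S\<^esub> x) k) = Some (p k)) \<and> (\<forall>k. B' k ((c \<odot>\<^bsub>M.S\<^esub> x) (\<sigma> k)) = Some (q k)) \<and>
        c \<odot>\<^bsub>F.S\<^esub> y = (\<lambda>k. p k \<oplus>\<^bsub>F k\<^esub> q k)" for c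
    proof (rule exI[of _ "\<lambda>k. c \<odot>\<^bsub>F k\<^esub> p k"], rule exI[of _ "\<lambda>k. c \<odot>\<^bsub>F k\<^esub> q k"], intro conjI allI)
      have "c \<odot>\<^bsub>F k\<^esub> (p k \<oplus>\<^bsub>F k\<^esub> q k) = c \<odot>\<^bsub>F k\<^esub> p k \<oplus>\<^bsub>F k\<^esub> c \<odot>\<^bsub>F k\<^esub> q k" for k
        using hF[of k] car module.smult_r_distr[of ring_of_type_algebra "F k"]
        by (simp add: hilbert_module_def ring_of_type_algebra_def)
      then show "c \<odot>\<^bsub>F.S\<^esub> y = (\<lambda>k. c \<odot>\<^bsub>F k\<^esub> p k \<oplus>\<^bsub>F k\<^esub> c \<odot>\<^bsub>F k\<^esub> q k)" by (simp add: pq(3))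
    qed (simp_all add: lin pq)
    show "\<exists>p q. (\<forall>k. A k ((x \<triangleleft>\<^bsub>M.S\<^esub> a) k) = Some (p k)) \<and> (\<forall>k. B' k ((x \<triangleleft>\<^bsub>M.S\<^esub> a) (\<sigma> k)) = Some (q k)) \<and>
        y \<triangleleft>\<^bsub>F.S\<^esub> a = (\<lambda>k. p k \<oplus>\<^bsub>F k\<^esub> q k)" for a
      by (intro exI[of _ "\<lambda>k. p k \<triangleleft>\<^bsub>F k\<^esub> a"] exI[of _ "\<lambda>k. q k \<triangleleft>\<^bsub>F k\<^esub> a"])
         (use car in \<open>simp add: lin pq hilbert_module.ract_add_left[OF hF]\<close>)
    fix x' y'
    assume "\<exists>p q. (\<forall>k. A k (x' k) = Some (p k)) \<and> (\<forall>k. B' k (x' (\<sigma> k)) = Some (q k)) \<and>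
        y' = (\<lambda>k. p k \<oplus>\<^bsub>F k\<^esub> q k)"
    then obtain p' q' where pq': "\<And>k. A k (x' k) = Some (p' k)" "\<And>k. B' k (x' (\<sigma> k)) = Some (q' k)"
        "y' = (\<lambda>k. p' k \<oplus>\<^bsub>F k\<^esub> q' k)" by blast
    note car' = carA[OF pq'(1)] carB[OF pq'(2)]
    have "(p k \<oplus>\<^bsub>F k\<^esub> q k) \<oplus>\<^bsub>F k\<^esub> (p' k \<oplus>\<^bsub>F k\<^esub> q' k) = (p k \<oplus>\<^bsub>F k\<^esub> p' k) \<oplus>\<^bsub>F k\<^esub> (q k \<oplus>\<^bsub>F k\<^esub> q' k)" for k
    proof -
      interpret hilbert_module "F k" by (rule hF)
      show ?thesis by (rule vector_eqI) (use car car' in \<open>simp_all add: ip_add_right add_ac\<close>)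
    qed
    then show "\<exists>p q. (\<forall>k. A k ((x \<oplus>\<^bsub>M.S\<^esub> x') k) = Some (p k)) \<and>
        (\<forall>k. B' k ((x \<oplus>\<^bsub>M.S\<^esub> x') (\<sigma> k)) = Some (q k)) \<and> y \<oplus>\<^bsub>F.S\<^esub> y' = (\<lambda>k. p k \<oplus>\<^bsub>F k\<^esub> q k)"
      by (intro exI[of _ "\<lambda>k. p k \<oplus>\<^bsub>F k\<^esub> p' k"] exI[of _ "\<lambda>k. q k \<oplus>\<^bsub>F k\<^esub> q' k"])
         (simp add: lin pq pq')
  qed
qed

text \<open>
  The cross terms \<open>A' B'\<close> and \<open>B A\<close> of \<open>D' D\<close> vanish, so \<open>1 + D' D\<close> acts diagonally, and on each component it is
  inverted by assumption.
\<close>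

lemma surjective: "surjective_one_plus (direct_sum M) D D'"
  unfolding surjective_one_plus_def
proof
  interpret M: finite_family M by (rule M)
  interpret F: finite_family F by (rule F)
  fix x assume "x \<in> carrier M.S"
  then have x: "x k \<in> carrier (M k)" for k by (simp add: M.carrier_direct_sum)
  have "\<exists>r b c d e. A k r = Some b \<and> A' k b = Some c \<and> B' (\<tau> k) r = Some d \<and>
      B (\<tau> k) d = Some e \<and> x k = r \<oplus>\<^bsub>M k\<^esub> (c \<oplus>\<^bsub>M k\<^esub> e)" for k
    using solve_M[of "x k" "\<tau> k"] x by auto
  then obtain r b c d e where r: "\<And>k. A k (r k) = Some (b k)" "\<And>k. A' k (b k) = Some (c k)"
      "\<And>k. B' (\<tau> k) (r k) = Some (d k)" "\<And>k. B (\<tau> k) (d k) = Some (e k)"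
      "\<And>k. x k = r k \<oplus>\<^bsub>M k\<^esub> (c k \<oplus>\<^bsub>M k\<^esub> e k)"
    by metis
  have B'r: "B' k (r (\<sigma> k)) = Some (d (\<sigma> k))" for k using r(3)[of "\<sigma> k"] by simp
  have Dr: "D r = Some (\<lambda>k. b k \<oplus>\<^bsub>F k\<^esub> d (\<sigma> k))"
    unfolding bidiagonal_op_eq_Some_iff using r(1) B'r
    by (intro exI[of _ b] exI[of _ "\<lambda>k. d (\<sigma> k)"]) simp
  have A'D: "A' k (b k \<oplus>\<^bsub>F k\<^esub> d (\<sigma> k)) = Some (c k \<oplus>\<^bsub>M k\<^esub> \<zero>\<^bsub>M k\<^esub>)" for k
    by (rule formal_adjoints.s_add[OF A r(2) A'B'[OF B'r]])
  have BD: "B (\<tau> k) (b (\<tau> k) \<oplus>\<^bsub>F (\<tau> k)\<^esub> d (\<sigma> (\<tau> k))) = Some (\<zero>\<^bsub>M k\<^esub> \<oplus>\<^bsub>M k\<^esub> e k)" for k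
    using formal_adjoints.t_add[OF B[of "\<tau> k"] BA[OF r(1)[of "\<tau> k"]] r(4)[of k]] by simp
  have D'D: "D' (\<lambda>k. b k \<oplus>\<^bsub>F k\<^esub> d (\<sigma> k)) =
      Some (\<lambda>k. (c k \<oplus>\<^bsub>M k\<^esub> \<zero>\<^bsub>M k\<^esub>) \<oplus>\<^bsub>M k\<^esub> (\<zero>\<^bsub>M k\<^esub> \<oplus>\<^bsub>M k\<^esub> e k))"
    unfolding bidiagonal_op_eq_Some_iff
    by (intro exI conjI allI) (rule A'D, rule BD, rule refl)
  have "x k = r k \<oplus>\<^bsub>M k\<^esub> ((c k \<oplus>\<^bsub>M k\<^esub> \<zero>\<^bsub>M k\<^esub>) \<oplus>\<^bsub>M k\<^esub> (\<zero>\<^bsub>M k\<^esub> \<oplus>\<^bsub>M k\<^esub> e k))" for k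
  proof -
    interpret hilbert_module "M k" by (rule M.hilbert)
    have "e k \<in> carrier (M k)" using formal_adjoints.t_carrier(2)[OF B[of "\<tau> k"] r(4)[of k]] by simp
    then show ?thesis using formal_adjoints.s_carrier[OF A r(2)[of k]] by (simp add: r(5))
  qed
  then have "x = r \<oplus>\<^bsub>M.S\<^esub> (\<lambda>k. (c k \<oplus>\<^bsub>M k\<^esub> \<zero>\<^bsub>M k\<^esub>) \<oplus>\<^bsub>M k\<^esub> (\<zero>\<^bsub>M k\<^esub> \<oplus>\<^bsub>M k\<^esub> e k))" by auto
  with Dr D'D show "\<exists>p q r. D p = Some q \<and> D' q = Some r \<and> x = p \<oplus>\<^bsub>M.S\<^esub> r" by blast
qed

lemma dense: "hdense (direct_sum M) (dom D)"
proof -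
  interpret M: finite_family M by (rule M)
  have "hdense M.S {x. \<forall>k. x k \<in> dom (A k) \<inter> dom (B' (\<tau> k))}"
    by (rule M.hdense_direct_sum) (metis dense_M \<sigma>\<tau>)
  moreover have "{x. \<forall>k. x k \<in> dom (A k) \<inter> dom (B' (\<tau> k))} = dom D"
  proof (intro equalityI subsetI)
    fix x assume "x \<in> {x. \<forall>k. x k \<in> dom (A k) \<inter> dom (B' (\<tau> k))}"
    then have "x k \<in> dom (A k)" "x (\<sigma> k) \<in> dom (B' (\<tau> (\<sigma> k)))" for k by blast+
    then show "x \<in> dom D" by (simp add: bidiagonal_op_def dom_def)
  next
    fix x assume "x \<in> dom D"
    then have *: "\<forall>k. x k \<in> dom (A k) \<and> x (\<sigma> k) \<in> dom (B' k)"
      by (auto simp: bidiagonal_op_def dom_def split: if_splits)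
    then have "x k \<in> dom (A k)" "x (\<sigma> (\<tau> k)) \<in> dom (B' (\<tau> k))" for k by blast+
    then show "x \<in> {x. \<forall>k. x k \<in> dom (A k) \<inter> dom (B' (\<tau> k))}" by simp
  qed
  ultimately show ?thesis by simp
qed

lemma adjointness:
  assumes "D x = Some y" "D' v = Some w"
  shows "\<langle>y, v\<rangle>\<^bsub>direct_sum F\<^esub> = \<langle>x, w\<rangle>\<^bsub>direct_sum M\<^esub>"
proof -
  interpret M: finite_family M by (rule M)
  interpret F: finite_family F by (rule F)
  obtain p q where pq: "\<And>k. A k (x k) = Some (p k)" "\<And>k. B' k (x (\<sigma> k)) = Some (q k)"
      "y = (\<lambda>k. p k \<oplus>\<^bsub>F k\<^esub> q k)" using assms(1) unfolding bidiagonal_op_eq_Some_iff by blast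
  obtain p' q' where pq': "\<And>k. A' k (v k) = Some (p' k)" "\<And>k. B (\<tau> k) (v (\<tau> k)) = Some (q' k)"
      "w = (\<lambda>k. p' k \<oplus>\<^bsub>M k\<^esub> q' k)" using assms(2) unfolding bidiagonal_op_eq_Some_iff by blast
  have Bv: "B k (v k) = Some (q' (\<sigma> k))" for k using pq'(2)[of "\<sigma> k"] by simp
  have q'M: "q' k \<in> carrier (M k)" for k using formal_adjoints.t_carrier(2)[OF B pq'(2)[of k]] by simp
  note car = formal_adjoints.t_carrier[OF A pq(1)] formal_adjoints.s_carrier(2)[OF B pq(2)]
    formal_adjoints.s_carrier[OF A pq'(1)] q'M
  have fin: "f summable_on UNIV" if "finite S" "\<And>k. k \<notin> S \<Longrightarrow> f k = 0" for f :: "'i \<Rightarrow> 'a" and S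
    by (rule finite_nonzero_values_imp_summable_on) (use that in \<open>metis (mono_tags) finite_subset mem_Collect_eq subsetI\<close>)
  \<comment> \<open>both pairings consist of a diagonal part f and an off-diagonal part g shifted by \<open>\<sigma>\<close>\<close>
  define f where "f k = \<langle>p k, v k\<rangle>\<^bsub>F k\<^esub>" for k
  define g where "g k = \<langle>x k, q' k\<rangle>\<^bsub>M k\<^esub>" for k
  have f: "f k = \<langle>x k, p' k\<rangle>\<^bsub>M k\<^esub>" for k
    unfolding f_def by (rule formal_adjoints.adjoint[OF A pq(1) pq'(1)])
  have g: "g (\<sigma> k) = \<langle>q k, v k\<rangle>\<^bsub>F k\<^esub>" for k
    unfolding g_def by (rule formal_adjoints.adjoint'[OF B Bv pq(2)])
  have sf: "f summable_on UNIV"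
    by (rule fin[OF M.finite_support_set]) (simp add: f M.ip_eq_zero car)
  have sg: "g summable_on UNIV"
    by (rule fin[OF M.finite_support_set]) (simp add: g_def M.ip_eq_zero car)
  have sg': "(\<lambda>k. g (\<sigma> k)) summable_on UNIV"
    by (rule fin[OF F.finite_support_set]) (simp add: g F.ip_eq_zero car)
  have bij: "bij \<sigma>" by (rule bijI') (metis \<tau>\<sigma>, metis \<sigma>\<tau>)
  have "\<langle>y, v\<rangle>\<^bsub>F.S\<^esub> = (\<Sum>\<^sub>\<infinity>k. f k + g (\<sigma> k))"
    unfolding F.ip_direct_sum_infsum pq(3) g f_def
    using car by (simp add: hilbert_module.ip_add_left[OF F.hilbert])
  also have "\<dots> = (\<Sum>\<^sub>\<infinity>k. f k) + (\<Sum>\<^sub>\<infinity>k. g (\<sigma> k))" by (rule infsum_add[OF sf sg'])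
  also have "(\<Sum>\<^sub>\<infinity>k. g (\<sigma> k)) = (\<Sum>\<^sub>\<infinity>k. g k)" by (rule infsum_reindex_bij_betw[OF bij])
  also have "(\<Sum>\<^sub>\<infinity>k. f k) + (\<Sum>\<^sub>\<infinity>k. g k) = (\<Sum>\<^sub>\<infinity>k. f k + g k)" by (rule infsum_add[OF sf sg, symmetric])
  also have "\<dots> = \<langle>x, w\<rangle>\<^bsub>M.S\<^esub>"
    unfolding M.ip_direct_sum_infsum pq'(3) f g_def
    using car by (simp add: hilbert_module.ip_add_right[OF M.hilbert])
  finally show ?thesis .
qed

lemma regular_bidiagonal:
  "regular (direct_sum M) (direct_sum F) D"
  "adjoint_op (direct_sum M) (direct_sum F) D = D'"
proof -
  interpret dual: bidiagonal F M A' A "\<lambda>k. B' (\<tau> k)" "\<lambda>k. B (\<tau> k)" \<tau> \<sigma> by (rule dual)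
  have D: "bidiagonal_op F A (\<lambda>k. B' (\<tau> (\<sigma> k))) \<sigma> = D" by simp
  have fa: "formal_adjoints (direct_sum M) (direct_sum F) D D'"
    by (intro formal_adjoints.intro formal_adjoints_axioms.intro
        finite_family.hilbert_module_direct_sum M F linear dual.linear adjointness)
  show "regular (direct_sum M) (direct_sum F) D" "adjoint_op (direct_sum M) (direct_sum F) D = D'"
    using formal_adjoints.regular_if_surjective[OF fa surjective _ dense dual.dense]
      dual.surjective[unfolded D] by simp_all
qed

end

section \<open>The Dirac operators of a Hilbert complex\<close>

locale finite_hilbert_complex =
  fixes N :: nat and E :: "int \<Rightarrow> ('a::cstar_algebra, 'e) hmodule" and t :: "int \<Rightarrow> 'e \<rightharpoonup> 'e"
  assumes complex: "finite_length_hilbert_complex N E t"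
begin

lemma composable:
  assumes jl: "j = k + 1" "l = k + 2"
  shows "composable_pair (E k) (E j) (E l) (t k) (t j)"
proof
  have "regular (E k) (E (k + 1)) (t k)" "regular (E (k + 1)) (E (k + 1 + 1)) (t (k + 1))"
    "ran (t k) \<subseteq> kernel_op (E (k + 2)) (t (k + 1))"
    using complex unfolding finite_length_hilbert_complex_def hilbert_complex_def by blast+
  then show "regular (E k) (E j) (t k)" "regular (E j) (E l) (t j)"
    "\<And>x y. t k x = Some y \<Longrightarrow> t j y = Some \<zero>\<^bsub>E l\<^esub>"
    using jl by (auto simp: kernel_op_def ran_def add.assoc)
qed

lemma finite_family:
  assumes "inj f"
  shows "finite_family (\<lambda>k. E (f k))"
proof (rule finite_family.intro)
  have "{k. carrier (E k) \<noteq> {\<zero>\<^bsub>E k\<^esub>}} \<subseteq> {0..int N + 1}"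
    using complex by (auto simp: finite_length_hilbert_complex_def)
  then have "finite (f -` {k. carrier (E k) \<noteq> {\<zero>\<^bsub>E k\<^esub>}})"
    using \<open>inj f\<close> by (intro finite_vimageI) (auto intro: finite_subset)
  then show "finite {k. carrier (E (f k)) \<noteq> {\<zero>\<^bsub>E (f k)\<^esub>}}" by (simp add: vimage_def)
  show "hilbert_module (E (f k))" for k
    using complex by (simp add: finite_length_hilbert_complex_def hilbert_complex_def)
qed

text \<open>
  The summand of index \<open>k\<close> of the even part lies in degree \<open>2k\<close> and that of the odd part in degree \<open>2k + 1\<close>. The
  diagonal operators start in even degrees and the off-diagonal ones in odd degrees.
\<close>

sublocale bidiagonal "\<lambda>k. E (2 * k)" "\<lambda>k. E (2 * k + 1)" "\<lambda>k. t (2 * k)" "\<lambda>k. adjoint_at E t (2 * k)"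
  "\<lambda>k. t (2 * k + 1)" "\<lambda>k. adjoint_at E t (2 * k + 1)" "\<lambda>k. k + 1" "\<lambda>k. k - 1"
proof (rule bidiagonal.intro)
  fix k :: int and x y
  interpret c0: composable_pair "E (2 * k)" "E (2 * k + 1)" "E (2 * (k + 1))" "t (2 * k)" "t (2 * k + 1)"
    by (rule composable) simp_all
  interpret c1: composable_pair "E (2 * k + 1)" "E (2 * (k + 1))" "E (2 * (k + 1) + 1)"
    "t (2 * k + 1)" "t (2 * (k + 1))"
    by (rule composable) simp_all
  have [simp]: "2 * k + 1 + 1 = 2 * (k + 1)" by simp
  show "formal_adjoints (E (2 * k)) (E (2 * k + 1)) (t (2 * k)) (adjoint_at E t (2 * k))"
    by (rule c0.formal_s)
  show "formal_adjoints (E (2 * k + 1)) (E (2 * (k + 1))) (t (2 * k + 1)) (adjoint_at E t (2 * k + 1))"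
    using c1.formal_s by simp
  show "t (2 * k) x = Some y \<Longrightarrow> t (2 * k + 1) y = Some \<zero>\<^bsub>E (2 * (k + 1))\<^esub>" by (rule c0.comp_zero)
  show "t (2 * k + 1) x = Some y \<Longrightarrow> t (2 * (k + 1)) y = Some \<zero>\<^bsub>E (2 * (k + 1) + 1)\<^esub>" by (rule c1.comp_zero)
  show "adjoint_at E t (2 * k + 1) x = Some y \<Longrightarrow> adjoint_at E t (2 * k) y = Some \<zero>\<^bsub>E (2 * k)\<^esub>"
    using c0.adjoint_comp_zero by simp
  show "adjoint_at E t (2 * (k + 1)) x = Some y \<Longrightarrow> adjoint_at E t (2 * k + 1) y = Some \<zero>\<^bsub>E (2 * k + 1)\<^esub>"
    using c1.adjoint_comp_zero by simp
  show "y \<in> carrier (E (2 * (k + 1))) \<Longrightarrow> \<exists>r b c d e. t (2 * (k + 1)) r = Some b \<and>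
      adjoint_at E t (2 * (k + 1)) b = Some c \<and> adjoint_at E t (2 * k + 1) r = Some d \<and>
      t (2 * k + 1) d = Some e \<and> y = r \<oplus>\<^bsub>E (2 * (k + 1))\<^esub> (c \<oplus>\<^bsub>E (2 * (k + 1))\<^esub> e)"
    using c1.solve_one_plus_laplacian[of y] by simp
  show "y \<in> carrier (E (2 * k + 1)) \<Longrightarrow> \<exists>r b c d e. t (2 * k + 1) r = Some b \<and>
      adjoint_at E t (2 * k + 1) b = Some c \<and> adjoint_at E t (2 * k) r = Some d \<and>
      t (2 * k) d = Some e \<and> y = r \<oplus>\<^bsub>E (2 * k + 1)\<^esub> (c \<oplus>\<^bsub>E (2 * k + 1)\<^esub> e)"
    using c0.solve_one_plus_laplacian[of y] by simp
  show "hdense (E (2 * (k + 1))) (dom (t (2 * (k + 1))) \<inter> dom (adjoint_at E t (2 * k + 1)))"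
    using c1.dense_common_domain by simp
  show "hdense (E (2 * k + 1)) (dom (t (2 * k + 1)) \<inter> dom (adjoint_at E t (2 * k)))"
    using c0.dense_common_domain by simp
qed (auto intro!: finite_family injI)

lemma dirac_even_eq: "dirac_even E t = D"
proof
  fix x
  interpret M: finite_family "\<lambda>k. E (2 * k)" by (rule M)
  have "(x \<in> carrier (even_part E) \<and> (\<forall>k. x k \<in> dom (t (2 * k)) \<inter> dom (adjoint_at E t (2 * k - 1)))) \<longleftrightarrow>
      (\<forall>k. x k \<in> dom (t (2 * k)) \<and> x (k + 1) \<in> dom (adjoint_at E t (2 * k + 1)))" (is "?L \<longleftrightarrow> ?R")
  proof
    assume L: ?L
    show ?R
    proof
      fix k
      have i: "2 * (k + 1) - 1 = 2 * k + 1" for k :: int by simp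
      have "x (k + 1) \<in> dom (adjoint_at E t (2 * (k + 1) - 1))" using L by blast
      then have "x (k + 1) \<in> dom (adjoint_at E t (2 * k + 1))" unfolding i .
      then show "x k \<in> dom (t (2 * k)) \<and> x (k + 1) \<in> dom (adjoint_at E t (2 * k + 1))" using L by blast
    qed
  next
    assume R: ?R
    have "x k \<in> carrier (E (2 * k))" for k
      using R formal_adjoints.t_carrier(1)[OF A] by blast
    moreover have "x k \<in> dom (adjoint_at E t (2 * k - 1))" for k
    proof -
      have i: "2 * (k - 1) + 1 = 2 * k - 1" "k - 1 + 1 = k" for k :: int by simp_all
      have "x (k - 1 + 1) \<in> dom (adjoint_at E t (2 * (k - 1) + 1))" using R by blast
      then show ?thesis unfolding i .
    qed
    ultimately show ?L using R by (simp add: even_part_def M.carrier_direct_sum)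
  qed
  then show "dirac_even E t x = D x" by (simp only: dirac_even_def bidiagonal_op_def)
qed

lemma dirac_odd_eq: "dirac_odd E t = D'"
proof
  fix y
  interpret F: finite_family "\<lambda>k. E (2 * k + 1)" by (rule F)
  have i: "2 * (k - 1) + 1 = 2 * k - 1" for k :: int by simp
  have "(y \<in> carrier (odd_part E) \<and> (\<forall>k. y k \<in> dom (adjoint_at E t (2 * k)) \<inter> dom (t (2 * k + 1)))) \<longleftrightarrow>
      (\<forall>k. y k \<in> dom (adjoint_at E t (2 * k)) \<and> y (k - 1) \<in> dom (t (2 * (k - 1) + 1)))" (is "?L \<longleftrightarrow> ?R")
  proof
    assume R: ?R
    have "y k \<in> carrier (E (2 * k + 1))" for k
      using R formal_adjoints.s_carrier(1)[OF A] by blast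
    moreover have "y k \<in> dom (t (2 * k + 1))" for k
    proof -
      have "y (k + 1 - 1) \<in> dom (t (2 * (k + 1 - 1) + 1))" using R by blast
      then show ?thesis by simp
    qed
    ultimately show ?L using R by (simp add: odd_part_def F.carrier_direct_sum)
  qed blast
  then show "dirac_odd E t y = D' y" by (simp only: dirac_odd_def bidiagonal_op_def i)
qed

end

theorem theorem1p3:
  fixes N :: nat
    and E :: "int \<Rightarrow> ('a::cstar_algebra, 'e) hmodule"
    and t :: "int \<Rightarrow> 'e \<rightharpoonup> 'e"
  assumes "finite_length_hilbert_complex N E t"
  shows "regular (even_part E) (odd_part E) (dirac_even E t) \<and>
         adjoint_op (even_part E) (odd_part E) (dirac_even E t) = dirac_odd E t"
proof -
  interpret finite_hilbert_complex N E t by unfold_locales (rule assms)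
  show ?thesis
    unfolding even_part_def odd_part_def dirac_even_eq dirac_odd_eq
    using regular_bidiagonal by blast
qed

end
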